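(* Let $\lambda\in\mathbf{k}$ be fixed, let $(X,\leq)$ be a well-ordered set and let $\leq_{\rm PL_l}$ be the left path-lexicographical order on the set $\mathfrak{S}(X)$ of nonunitary bracketed words on $X$ (defined in the context). (a) The set $$S_{\rm rbl}:=\big\{\lfloor\lfloor x\rfloor y\rfloor+\lfloor x\lfloor y\rfloor\rfloor+\lambda\lfloor xy\rfloor-\lfloor x\rfloor\lfloor y\rfloor\ \big|\ x,y\in\mathfrak{S}(X)\big\}$$ is a Gröbner-Shirshov basis in $\mathbf{k}\mathfrak{S}(X)$ with respect to $\leq_{\rm PL_l}$. (b) The set $$\mathrm{Irr}(S_{\rm rbl}):=\mathfrak{S}(X)\setminus\big\{q|_{\lfloor\lfloor x\rfloor y\rfloor}\ \big|\ x,y\in\mathfrak{S}(X),\ q\in\mathfrak{S}^\star(X)\big\}$$ is (via its image in the quotient) a $\mathbf{k}$-basis of the free nonunitary Rota-Baxter algebra $\mathbf{k}\mathfrak{S}(X)/\mathrm{Id}(S_{\rm rbl})$ (of weight $\lambda$) on $X$.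
   Context: $\mathbf{k}$ is a unitary commutative ring of characteristic zero; nonunitary algebras are associative, not necessarily commutative $\mathbf{k}$-algebras, not required to have a unit. A nonunitary Rota-Baxter algebra of weight $\lambda$ is a nonunitary algebra $A$ with a linear operator $P:A\to A$ such that $P(x)P(y)=P(P(x)y)+P(xP(y))+\lambda P(xy)$ for all $x,y\in A$. Nonunitary bracketed words. For a set $Y$, let $\mathrm{Sg}(Y)$ be the free semigroup on $Y$ (nonempty words). Put $\mathfrak{S}_0(X)=\mathrm{Sg}(X)$ and $\mathfrak{S}_n(X)=\mathrm{Sg}(X\sqcup\lfloor\mathfrak{S}_{n-1}(X)\rfloor)$ for $n\ge1$, where $\lfloor Y\rfloor=\{\lfloor u\rfloor\mid u\in Y\}$ is a disjoint copy of $Y$; with the natural embeddings, $\mathfrak{S}(X)=\bigcup_{n\ge0}\mathfrak{S}_n(X)$. Each $w\in\mathfrak{S}(X)$ is uniquely $w=w_1\cdots w_k$, $k\ge1$, with $w_i\in X\sqcup\lfloor\mathfrak{S}(X)\rfloor$ (prime elements); $|w|=k$ is the breadth. $\mathbf{k}\mathfrak{S}(X)$ is the free module on $\mathfrak{S}(X)$, a nonunitary algebra with the linear operator extending $w\mapsto\lfloor w\rfloor$. $\mathrm{Id}(S)$ is the operated ideal generated by $S$ (smallest ideal containing $S$ and closed under $\lfloor\ \rfloor$); quotients carry the induced operator. $\star$-bracketed words. For a symbol $\star\notin X$, $\mathfrak{S}^\star(X)$ is the set of elements of $\mathfrak{S}(X\sqcup\{\star\})$ in which $\star$ occurs exactly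 once; $q|_u$ replaces $\star$ in $q$ by $u\in\mathfrak{S}(X)$, and $q|_s=\sum_ic_iq|_{u_i}$ for $s=\sum_ic_iu_i\in\mathbf{k}\mathfrak{S}(X)$. Order. $\deg(w)$ is the total number of occurrences in $w$ of letters of $X$. Let $P,\mu$ be two symbols not in $X$, and $M(X\sqcup\{P,\mu\})$ the free monoid. If $x_1,\dots,x_k$ are the occurrences of letters of $X$ in $w$ from left to right, define $\mathrm{Path}_w(x_i)\in M(X\sqcup\{P,\mu\})$ recursively: if $w=x_i\in X$, it is $x_i$; if $w=\lfloor w'\rfloor$, it is $P\,\mathrm{Path}_{w'}(x_i)$; if $w=w_1\cdots w_n$ with $n\ge2$, $w_j$ prime, and the occurrence $x_i$ lies in $w_j$, it is $\mu\,\mathrm{Path}_{w_j}(x_i)$. Put $\mathrm{Path}_{\rm l}(w)=(\mathrm{Path}_w(x_1),\dots,\mathrm{Path}_w(x_k))$. Extend the order of $X$ to $X\sqcup\{P,\mu\}$ by $x<P<\mu$ for all $x\in X$ and order $M(X\sqcup\{P,\mu\})$ by the degree lexicographical order (length first, then lexicographically from the left). Define $u\leq_{\rm PL_l}v$ iff $(\deg(u),\mathrm{Path}_{\rm l}(u))\leq(\deg(v),\mathrm{Path}_{\rm l}(v))$ lexicographically, individual paths being compared by the degree lexicographical order. Gröbner-Shirshov bases. With respect to the order, $\overline{s}$ denotes the leading (largest) monomial of $0\ne s\in\mathbf{k}\mathfrak{S}(X)$; $s$ is monic if $\overline{s}$ has coefficient $1$. Let $f,g$ be monic. If $w=\overline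 fu=v\overline g$ with $u,v,w\in\mathfrak{S}(X)$ and $\max\{|\overline f|,|\overline g|\}<|w|<|\overline f|+|\overline g|$, then $fu-vg$ is an intersection composition with respect to $w$. If $w=\overline f=q|_{\overline g}$ with $q\in\mathfrak{S}^\star(X)$, then $f-q|_g$ is an including composition with respect to $w$. An element $h$ is trivial modulo $(S,w)$ if $h=\sum_ic_iq_i|_{s_i}$ with $c_i\in\mathbf{k}$, $q_i\in\mathfrak{S}^\star(X)$, $s_i\in S$ and $\overline{q_i|_{s_i}}<w$. A monic set $S$ is a Gröbner-Shirshov basis if all intersection and including compositions (with respect to $w$) of pairs in $S$ are trivial modulo $(S,w)$. *)

theory Defs
  imports "HOL-Algebra.Algebraic_Closure_Type" "HOL-Library.Poly_Mapping"
begin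

section \<open>Nonunitary bracketed words\<close>

text \<open>
  The increasing union of the stages \<open>Sg (X \<squnion> \<lfloor>\<dots>\<rfloor>)\<close> is the least fixed point of
  \<open>W = Sg (X \<squnion> \<lfloor>W\<rfloor>)\<close>, hence a mutually recursive datatype: a bracketed word is a nonempty
  sequence of primes (either a single prime, or a prime followed by a word), and a prime is a
  letter or a bracketed word \<open>\<lfloor>w\<rfloor>\<close>. The set \<open>X\<close> of letters is the type \<open>'x\<close>.
\<close>

datatype 'x bword = Sing "'x bprime" | Conc "'x bprime" "'x bword"
     and 'x bprime = Letter 'x | Brk "'x bword"

abbreviation bletter :: "'x \<Rightarrow> 'x bword" where
  "bletter x \<equiv> Sing (Letter x)"

abbreviation bracket :: "'x bword \<Rightarrow> 'x bword" where
  "bracket w \<equiv> Sing (Brk w)"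

primrec bmul :: "'x bword \<Rightarrow> 'x bword \<Rightarrow> 'x bword" (infixr \<open>\<cdot>\<close> 75) where
  "Sing p \<cdot> v = Conc p v"
| "Conc p u \<cdot> v = Conc p (u \<cdot> v)"

primrec breadth :: "'x bword \<Rightarrow> nat" where
  "breadth (Sing p) = 1"
| "breadth (Conc p w) = Suc (breadth w)"

text \<open>The occurrences of letters, from left to right.\<close>

primrec letters :: "'x bword \<Rightarrow> 'x list"
    and letters_prime :: "'x bprime \<Rightarrow> 'x list" where
  "letters (Sing p) = letters_prime p"
| "letters (Conc p w) = letters_prime p @ letters w"
| "letters_prime (Letter x) = [x]"
| "letters_prime (Brk w) = letters w"

definition bdeg :: "'x bword \<Rightarrow> nat" where
  "bdeg w = length (letters w)"

text \<open>The alphabet \<open>X \<squnion> {\<star>}\<close> is \<open>'x option\<close>, with \<open>None\<close> in the role of \<open>\<star>\<close>.\<close>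

definition star_words :: "'x option bword set" where
  "star_words = {q. count_list (letters q) None = 1}"

primrec star_subst :: "'x option bword \<Rightarrow> 'x bword \<Rightarrow> 'x bword"
    and star_subst_prime :: "'x option bprime \<Rightarrow> 'x bword \<Rightarrow> 'x bword" where
  "star_subst (Sing p) u = star_subst_prime p u"
| "star_subst (Conc p w) u = star_subst_prime p u \<cdot> star_subst w u"
| "star_subst_prime (Letter a) u = (case a of None \<Rightarrow> u | Some x \<Rightarrow> bletter x)"
| "star_subst_prime (Brk w) u = bracket (star_subst w u)"


section \<open>The left path-lexicographical order\<close>

datatype 'x path_symbol = Gen 'x | SymP | SymMu

fun symbol_less :: "'x::linorder path_symbol \<Rightarrow> 'x path_symbol \<Rightarrow> bool" where
  "symbol_less (Gen x) (Gen y) \<longleftrightarrow> x < y"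
| "symbol_less (Gen x) SymP \<longleftrightarrow> True"
| "symbol_less (Gen x) SymMu \<longleftrightarrow> True"
| "symbol_less SymP SymMu \<longleftrightarrow> True"
| "symbol_less _ _ \<longleftrightarrow> False"

text \<open>
  \<open>path_list w\<close> is the list of the paths of all occurrences of letters in \<open>w\<close>. For a product of at
  least two primes, \<open>\<mu>\<close> is put in front of every path of every prime factor exactly once; the
  function \<open>factor_paths\<close> collects the paths of the prime factors without that symbol.
\<close>

fun path_list :: "'x bword \<Rightarrow> 'x path_symbol list list"
  and factor_paths :: "'x bword \<Rightarrow> 'x path_symbol list list"
  and prime_paths :: "'x bprime \<Rightarrow> 'x path_symbol list list" where
  "path_list (Sing p) = prime_paths p"
| "path_list (Conc p w) = map ((#) SymMu) (prime_paths p @ factor_paths w)"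
| "factor_paths (Sing p) = prime_paths p"
| "factor_paths (Conc p w) = prime_paths p @ factor_paths w"
| "prime_paths (Letter x) = [[Gen x]]"
| "prime_paths (Brk w) = map ((#) SymP) (path_list w)"

text \<open>
  \<open>lenlex\<close> is the degree lexicographical order on paths. Lists of paths are compared only when the
  degrees, that is the lengths of these lists, agree; \<open>lex\<close> relates lists of equal length.
\<close>

definition pl_key_less :: "((nat \<times> 'x::linorder path_symbol list list) \<times> (nat \<times> 'x path_symbol list list)) set" where
  "pl_key_less = less_than <*lex*> lex (lenlex {(a, b). symbol_less a b})"

definition pl_le :: "'x::linorder bword \<Rightarrow> 'x bword \<Rightarrow> bool" where
  "pl_le u v \<longleftrightarrow> (bdeg u, path_list u) = (bdeg v, path_list v)
     \<or> ((bdeg u, path_list u), (bdeg v, path_list v)) \<in> pl_key_less"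


section \<open>The free module on bracketed words\<close>

text \<open>
  \<open>'x bword \<Rightarrow>\<^sub>0 'k\<close> is the free \<open>'k\<close>-module on bracketed words. It has no unit, so
  the multiplication that \<^theory>\<open>HOL-Library.Poly_Mapping\<close> provides for monoid exponents does not
  apply.
\<close>

definition kmono :: "'x bword \<Rightarrow> ('x bword \<Rightarrow>\<^sub>0 'k::comm_ring_1)" where
  "kmono w = Poly_Mapping.single w 1"

definition kscale :: "'k::comm_ring_1 \<Rightarrow> ('x bword \<Rightarrow>\<^sub>0 'k) \<Rightarrow> ('x bword \<Rightarrow>\<^sub>0 'k)" where
  "kscale c f = Poly_Mapping.map ((*) c) f"

definition kmul :: "('x bword \<Rightarrow>\<^sub>0 'k::comm_ring_1) \<Rightarrow> ('x bword \<Rightarrow>\<^sub>0 'k) \<Rightarrow> ('x bword \<Rightarrow>\<^sub>0 'k)" where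
  "kmul f g = (\<Sum>u\<in>Poly_Mapping.keys f. \<Sum>v\<in>Poly_Mapping.keys g.
     Poly_Mapping.single (u \<cdot> v) (Poly_Mapping.lookup f u * Poly_Mapping.lookup g v))"

definition kbracket :: "('x bword \<Rightarrow>\<^sub>0 'k::comm_ring_1) \<Rightarrow> ('x bword \<Rightarrow>\<^sub>0 'k)" where
  "kbracket f = (\<Sum>u\<in>Poly_Mapping.keys f. Poly_Mapping.single (bracket u) (Poly_Mapping.lookup f u))"

definition ksubst :: "'x option bword \<Rightarrow> ('x bword \<Rightarrow>\<^sub>0 'k::comm_ring_1) \<Rightarrow> ('x bword \<Rightarrow>\<^sub>0 'k)" where
  "ksubst q f = (\<Sum>u\<in>Poly_Mapping.keys f. Poly_Mapping.single (star_subst q u) (Poly_Mapping.lookup f u))"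


section \<open>Groebner-Shirshov bases\<close>

text \<open>
  Everything is stated with respect to a relation \<open>leq\<close>, whose strict part is the associated
  strict order. The leading monomial is the monomial of the support that is strictly larger than all
  other monomials of the support. For a linear order this is the maximum of the support. However,
  \<open>pl_le\<close> is only a total preorder on words: for instance \<open>\<lfloor>xy\<rfloor>\<lfloor>zab\<rfloor>\<close> and
  \<open>\<lfloor>xyz\<rfloor>\<lfloor>ab\<rfloor>\<close> have the same paths. Hence the leading monomial is a relation, and its existence
  is part of being monic.
\<close>

definition strict_part :: "('w \<Rightarrow> 'w \<Rightarrow> bool) \<Rightarrow> 'w \<Rightarrow> 'w \<Rightarrow> bool" where
  "strict_part leq u v \<longleftrightarrow> leq u v \<and> \<not> leq v u"

definition is_lead :: "('x bword \<Rightarrow> 'x bword \<Rightarrow> bool) \<Rightarrow> ('x bword \<Rightarrow>\<^sub>0 'k::comm_ring_1) \<Rightarrow> 'x bword \<Rightarrow> bool" where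
  "is_lead leq f w \<longleftrightarrow> w \<in> Poly_Mapping.keys f \<and>
     (\<forall>u \<in> Poly_Mapping.keys f. u \<noteq> w \<longrightarrow> strict_part leq u w)"

definition kmonic :: "('x bword \<Rightarrow> 'x bword \<Rightarrow> bool) \<Rightarrow> ('x bword \<Rightarrow>\<^sub>0 'k::comm_ring_1) \<Rightarrow> bool" where
  "kmonic leq f \<longleftrightarrow> (\<exists>w. is_lead leq f w \<and> Poly_Mapping.lookup f w = 1)"

definition trivial_mod ::
  "('x bword \<Rightarrow> 'x bword \<Rightarrow> bool) \<Rightarrow> ('x bword \<Rightarrow>\<^sub>0 'k::comm_ring_1) set \<Rightarrow> 'x bword \<Rightarrow> ('x bword \<Rightarrow>\<^sub>0 'k) \<Rightarrow> bool"
where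
  "trivial_mod leq S w h \<longleftrightarrow> (\<exists>(n::nat) c q s.
     (\<forall>i<n. q i \<in> star_words \<and> s i \<in> S \<and>
        (\<exists>v. is_lead leq (ksubst (q i) (s i)) v \<and> strict_part leq v w)) \<and>
     h = (\<Sum>i<n. kscale (c i) (ksubst (q i) (s i))))"

definition intersection_composition ::
  "('x bword \<Rightarrow> 'x bword \<Rightarrow> bool) \<Rightarrow> ('x bword \<Rightarrow>\<^sub>0 'k::comm_ring_1) \<Rightarrow> ('x bword \<Rightarrow>\<^sub>0 'k) \<Rightarrow> 'x bword \<Rightarrow> ('x bword \<Rightarrow>\<^sub>0 'k) \<Rightarrow> bool"
where
  "intersection_composition leq f g w h \<longleftrightarrow> (\<exists>f0 g0 u v.
     is_lead leq f f0 \<and> is_lead leq g g0 \<and> w = f0 \<cdot> u \<and> w = v \<cdot> g0 \<and>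
     max (breadth f0) (breadth g0) < breadth w \<and> breadth w < breadth f0 + breadth g0 \<and>
     h = kmul f (kmono u) - kmul (kmono v) g)"

definition including_composition ::
  "('x bword \<Rightarrow> 'x bword \<Rightarrow> bool) \<Rightarrow> ('x bword \<Rightarrow>\<^sub>0 'k::comm_ring_1) \<Rightarrow> ('x bword \<Rightarrow>\<^sub>0 'k) \<Rightarrow> 'x bword \<Rightarrow> ('x bword \<Rightarrow>\<^sub>0 'k) \<Rightarrow> bool"
where
  "including_composition leq f g w h \<longleftrightarrow> (\<exists>g0. \<exists>q \<in> star_words.
     is_lead leq f w \<and> is_lead leq g g0 \<and> w = star_subst q g0 \<and> h = f - ksubst q g)"

definition groebner_shirshov_basis ::
  "('x bword \<Rightarrow> 'x bword \<Rightarrow> bool) \<Rightarrow> ('x bword \<Rightarrow>\<^sub>0 'k::comm_ring_1) set \<Rightarrow> bool"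
where
  "groebner_shirshov_basis leq S \<longleftrightarrow> (\<forall>s\<in>S. kmonic leq s) \<and>
     (\<forall>f\<in>S. \<forall>g\<in>S. \<forall>w h.
        intersection_composition leq f g w h \<or> including_composition leq f g w h
          \<longrightarrow> trivial_mod leq S w h)"


section \<open>Nonunitary operated and Rota-Baxter algebras\<close>

text \<open>
  The record inherits a field \<open>one\<close> from \<open>ring\<close>, which is ignored throughout: no unit is required
  of the algebras and homomorphisms below.
\<close>

record ('k, 'a) operated_algebra = "('k, 'a) module" +
  oper :: "'a \<Rightarrow> 'a"

locale nonunitary_algebra = module R A for R (structure) and A (structure) +
  assumes mult_closed: "\<lbrakk>x \<in> carrier A; y \<in> carrier A\<rbrakk> \<Longrightarrow> x \<otimes>\<^bsub>A\<^esub> y \<in> carrier A"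
    and mult_assoc: "\<lbrakk>x \<in> carrier A; y \<in> carrier A; z \<in> carrier A\<rbrakk>
      \<Longrightarrow> (x \<otimes>\<^bsub>A\<^esub> y) \<otimes>\<^bsub>A\<^esub> z = x \<otimes>\<^bsub>A\<^esub> (y \<otimes>\<^bsub>A\<^esub> z)"
    and distr_left: "\<lbrakk>x \<in> carrier A; y \<in> carrier A; z \<in> carrier A\<rbrakk>
      \<Longrightarrow> (x \<oplus>\<^bsub>A\<^esub> y) \<otimes>\<^bsub>A\<^esub> z = x \<otimes>\<^bsub>A\<^esub> z \<oplus>\<^bsub>A\<^esub> y \<otimes>\<^bsub>A\<^esub> z"
    and distr_right: "\<lbrakk>x \<in> carrier A; y \<in> carrier A; z \<in> carrier A\<rbrakk>
      \<Longrightarrow> x \<otimes>\<^bsub>A\<^esub> (y \<oplus>\<^bsub>A\<^esub> z) = x \<otimes>\<^bsub>A\<^esub> y \<oplus>\<^bsub>A\<^esub> x \<otimes>\<^bsub>A\<^esub> z"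
    and smult_mult_left: "\<lbrakk>c \<in> carrier R; x \<in> carrier A; y \<in> carrier A\<rbrakk>
      \<Longrightarrow> (c \<odot>\<^bsub>A\<^esub> x) \<otimes>\<^bsub>A\<^esub> y = c \<odot>\<^bsub>A\<^esub> (x \<otimes>\<^bsub>A\<^esub> y)"
    and smult_mult_right: "\<lbrakk>c \<in> carrier R; x \<in> carrier A; y \<in> carrier A\<rbrakk>
      \<Longrightarrow> x \<otimes>\<^bsub>A\<^esub> (c \<odot>\<^bsub>A\<^esub> y) = c \<odot>\<^bsub>A\<^esub> (x \<otimes>\<^bsub>A\<^esub> y)"

locale nonunitary_rota_baxter_algebra = nonunitary_algebra R A
  for R (structure) and A :: "('k, 'a) operated_algebra" (structure) and lam +
  assumes weight_closed: "lam \<in> carrier R"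
    and oper_closed: "x \<in> carrier A \<Longrightarrow> oper A x \<in> carrier A"
    and oper_add: "\<lbrakk>x \<in> carrier A; y \<in> carrier A\<rbrakk>
      \<Longrightarrow> oper A (x \<oplus>\<^bsub>A\<^esub> y) = oper A x \<oplus>\<^bsub>A\<^esub> oper A y"
    and oper_smult: "\<lbrakk>c \<in> carrier R; x \<in> carrier A\<rbrakk>
      \<Longrightarrow> oper A (c \<odot>\<^bsub>A\<^esub> x) = c \<odot>\<^bsub>A\<^esub> oper A x"
    and rota_baxter: "\<lbrakk>x \<in> carrier A; y \<in> carrier A\<rbrakk>
      \<Longrightarrow> oper A x \<otimes>\<^bsub>A\<^esub> oper A y =
          oper A (oper A x \<otimes>\<^bsub>A\<^esub> y) \<oplus>\<^bsub>A\<^esub> oper A (x \<otimes>\<^bsub>A\<^esub> oper A y)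
            \<oplus>\<^bsub>A\<^esub> lam \<odot>\<^bsub>A\<^esub> oper A (x \<otimes>\<^bsub>A\<^esub> y)"

definition operated_hom ::
  "'k ring \<Rightarrow> ('k, 'a) operated_algebra \<Rightarrow> ('k, 'b) operated_algebra \<Rightarrow> ('a \<Rightarrow> 'b) set"
where
  "operated_hom R A B = {h. h \<in> carrier A \<rightarrow> carrier B \<and>
     (\<forall>x \<in> carrier A. \<forall>y \<in> carrier A. h (x \<oplus>\<^bsub>A\<^esub> y) = h x \<oplus>\<^bsub>B\<^esub> h y) \<and>
     (\<forall>c \<in> carrier R. \<forall>x \<in> carrier A. h (c \<odot>\<^bsub>A\<^esub> x) = c \<odot>\<^bsub>B\<^esub> h x) \<and>
     (\<forall>x \<in> carrier A. \<forall>y \<in> carrier A. h (x \<otimes>\<^bsub>A\<^esub> y) = h x \<otimes>\<^bsub>B\<^esub> h y) \<and>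
     (\<forall>x \<in> carrier A. h (oper A x) = oper B (h x))}"

text \<open>
  \<open>A\<close> with the map \<open>j\<close> from the type \<open>'x\<close> of generators is free among the nonunitary
  Rota-Baxter algebras of weight \<open>lam\<close>. A definition cannot quantify over types, so the type \<open>'b\<close> of
  the elements of the target algebras is a parameter, to be left as a type variable in theorems.
\<close>

definition free_nonunitary_rota_baxter_algebra ::
  "'b itself \<Rightarrow> 'k ring \<Rightarrow> 'k \<Rightarrow> ('k, 'a) operated_algebra \<Rightarrow> ('x \<Rightarrow> 'a) \<Rightarrow> bool"
where
  "free_nonunitary_rota_baxter_algebra T R lam A j \<longleftrightarrow>
     nonunitary_rota_baxter_algebra R A lam \<and> range j \<subseteq> carrier A \<and>
     (\<forall>(B :: ('k, 'b) operated_algebra) f.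
        nonunitary_rota_baxter_algebra R B lam \<and> range f \<subseteq> carrier B \<longrightarrow>
        (\<exists>!h. h \<in> operated_hom R A B \<and> h \<in> extensional (carrier A) \<and> (\<forall>x. h (j x) = f x)))"

definition operated_ideal :: "'k ring \<Rightarrow> ('k, 'a) operated_algebra \<Rightarrow> 'a set \<Rightarrow> bool" where
  "operated_ideal R A I \<longleftrightarrow> submodule I R A \<and>
     (\<forall>a \<in> carrier A. \<forall>x \<in> I. a \<otimes>\<^bsub>A\<^esub> x \<in> I \<and> x \<otimes>\<^bsub>A\<^esub> a \<in> I) \<and> (\<forall>x \<in> I. oper A x \<in> I)"

definition operated_Id :: "'k ring \<Rightarrow> ('k, 'a) operated_algebra \<Rightarrow> 'a set \<Rightarrow> 'a set" where
  "operated_Id R A S = \<Inter> {I. operated_ideal R A I \<and> S \<subseteq> I}"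

text \<open>The operations on cosets are those of \<^const>\<open>FactRing\<close>, extended in the same style.\<close>

definition quotient_algebra :: "('k, 'a) operated_algebra \<Rightarrow> 'a set \<Rightarrow> ('k, 'a set) operated_algebra" where
  "quotient_algebra A I =
    \<lparr>carrier = a_rcosets\<^bsub>A\<^esub> I, monoid.mult = rcoset_mult A I, one = I +>\<^bsub>A\<^esub> \<one>\<^bsub>A\<^esub>,
     ring.zero = I, add = set_add A,
     module.smult = (\<lambda>c C. \<Union>a\<in>C. I +>\<^bsub>A\<^esub> (c \<odot>\<^bsub>A\<^esub> a)),
     oper = (\<lambda>C. \<Union>a\<in>C. I +>\<^bsub>A\<^esub> oper A a)\<rparr>"

text \<open>The family \<open>(b i)\<close>, \<open>i \<in> I\<close>, is a basis: it spans and is linearly independent.\<close>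

definition basis_family :: "'k ring \<Rightarrow> ('k, 'a, 'm) module_scheme \<Rightarrow> 'i set \<Rightarrow> ('i \<Rightarrow> 'a) \<Rightarrow> bool" where
  "basis_family R M I b \<longleftrightarrow> b ` I \<subseteq> carrier M \<and>
     (\<forall>m \<in> carrier M. \<exists>F c. finite F \<and> F \<subseteq> I \<and> c \<in> F \<rightarrow> carrier R \<and>
        m = (\<Oplus>\<^bsub>M\<^esub>i\<in>F. c i \<odot>\<^bsub>M\<^esub> b i)) \<and>
     (\<forall>F c. finite F \<and> F \<subseteq> I \<and> c \<in> F \<rightarrow> carrier R \<and>
        (\<Oplus>\<^bsub>M\<^esub>i\<in>F. c i \<odot>\<^bsub>M\<^esub> b i) = \<zero>\<^bsub>M\<^esub> \<longrightarrow> (\<forall>i\<in>F. c i = \<zero>\<^bsub>R\<^esub>))"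

definition bword_algebra :: "('k::comm_ring_1, 'x bword \<Rightarrow>\<^sub>0 'k) operated_algebra" where
  "bword_algebra =
    \<lparr>carrier = UNIV, monoid.mult = kmul, one = undefined, ring.zero = 0, add = (+),
     module.smult = kscale, oper = kbracket\<rparr>"


section \<open>The Rota-Baxter relations\<close>

definition S_rbl :: "'k::comm_ring_1 \<Rightarrow> ('x bword \<Rightarrow>\<^sub>0 'k) set" where
  "S_rbl lam = {kmono (bracket (bracket x \<cdot> y)) + kmono (bracket (x \<cdot> bracket y))
     + kscale lam (kmono (bracket (x \<cdot> y))) - kmono (bracket x \<cdot> bracket y) | x y. True}"

definition Irr_rbl :: "'x bword set" where
  "Irr_rbl = UNIV - {star_subst q (bracket (bracket x \<cdot> y)) | q x y. q \<in> star_words}"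

abbreviation Id_rbl :: "'k::comm_ring_1 \<Rightarrow> ('x bword \<Rightarrow>\<^sub>0 'k) set" where
  "Id_rbl lam \<equiv> operated_Id ring_of_type_algebra bword_algebra (S_rbl lam)"

definition rbl_quotient :: "'k::comm_ring_1 \<Rightarrow> ('k, ('x bword \<Rightarrow>\<^sub>0 'k) set) operated_algebra" where
  "rbl_quotient lam = quotient_algebra bword_algebra (Id_rbl lam)"

definition rbl_class :: "'k::comm_ring_1 \<Rightarrow> 'x bword \<Rightarrow> ('x bword \<Rightarrow>\<^sub>0 'k) set" where
  "rbl_class lam w = Id_rbl lam +>\<^bsub>bword_algebra\<^esub> kmono w"

end

theory Submission
  imports Defs
begin

text \<open>
  For part (a) the breadth of every leading word is one, so there are no intersections, and the only
  inclusions place \<open>\<lfloor>\<lfloor>u\<rfloor>v\<rfloor>\<close> inside \<open>x\<close> or \<open>y\<close>, or equal to \<open>\<lfloor>x\<rfloor>\<close>, in \<open>\<lfloor>\<lfloor>x\<rfloor>y\<rfloor>\<close>. All words that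
  occur in the reductions are smaller because the path of their first differing letter is shorter.

  For part (b) no rewriting theory is needed. On the free module, with concatenation as the product,
  the recursion \<open>P(\<lfloor>x\<rfloor>y) = \<lfloor>x\<rfloor>P(y) - P(xP(y)) - \<lambda>P(xy)\<close> and \<open>P(w) = \<lfloor>w\<rfloor>\<close> for all other words
  terminates, since it lowers the degree or the number of brackets around the first letter, and it
  defines a Rota-Baxter operator. The operated homomorphism \<open>N\<close> that fixes the letters and turns
  the bracket into \<open>P\<close> therefore vanishes on the ideal; it fixes all irreducible words, its values
  are supported in irreducible words, and \<open>N f - f\<close> always lies in the ideal.
\<close>

section \<open>The free module on bracketed words\<close>

lemma lookup_kscale [simp]: "Poly_Mapping.lookup (kscale c f) w = c * Poly_Mapping.lookup f w"
  unfolding kscale_def by (simp add: map.rep_eq when_def)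

lemma kscale_add_right: "kscale c (f + g) = kscale c f + kscale c g"
  by (rule poly_mapping_eqI) (simp add: lookup_add algebra_simps)

lemma kscale_diff_right: "kscale c (f - g) = kscale c f - kscale c g"
  by (rule poly_mapping_eqI) (simp add: lookup_minus algebra_simps)

lemma kscale_add_left: "kscale (c + d) f = kscale c f + kscale d f"
  by (rule poly_mapping_eqI) (simp add: lookup_add algebra_simps)

lemma kscale_kscale [simp]: "kscale c (kscale d f) = kscale (c * d) f"
  by (rule poly_mapping_eqI) (simp add: algebra_simps)

lemma kscale_one [simp]: "kscale 1 f = f"
  by (rule poly_mapping_eqI) simp

lemma kscale_zero_left [simp]: "kscale 0 f = 0"
  by (rule poly_mapping_eqI) simp

lemma kscale_zero_right [simp]: "kscale c 0 = 0"
  by (rule poly_mapping_eqI) simp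

lemma kscale_minus_one: "kscale (- 1) f = - f"
  by (rule poly_mapping_eqI) simp

lemma kscale_sum: "kscale c (\<Sum>i\<in>A. f i) = (\<Sum>i\<in>A. kscale c (f i))"
  by (rule poly_mapping_eqI) (simp add: lookup_sum sum_distrib_left)

lemma single_conv_kmono: "Poly_Mapping.single w c = kscale c (kmono w)"
  by (rule poly_mapping_eqI) (simp add: kmono_def lookup_single when_def)

lemma lookup_kmono: "Poly_Mapping.lookup (kmono w) v = (if v = w then 1 else 0)"
  by (simp add: kmono_def lookup_single when_def)

lemma keys_kmono [simp]: "Poly_Mapping.keys (kmono w :: 'x bword \<Rightarrow>\<^sub>0 'k::comm_ring_1) = {w}"
  by (simp add: kmono_def)

lemma keys_kscale: "Poly_Mapping.keys (kscale c f) \<subseteq> Poly_Mapping.keys f"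
  by (auto simp: in_keys_iff)

lemma kmono_expansion:
  "f = (\<Sum>u\<in>Poly_Mapping.keys f. kscale (Poly_Mapping.lookup f u) (kmono u))"
proof (rule poly_mapping_eqI)
  fix w
  have "Poly_Mapping.lookup (\<Sum>u\<in>Poly_Mapping.keys f. kscale (Poly_Mapping.lookup f u) (kmono u)) w
      = (\<Sum>u\<in>Poly_Mapping.keys f. if w = u then Poly_Mapping.lookup f u else 0)"
    unfolding lookup_sum by (rule sum.cong) (auto simp: lookup_kmono)
  also have "\<dots> = Poly_Mapping.lookup f w"
    by (simp add: in_keys_iff)
  finally show "Poly_Mapping.lookup f w = Poly_Mapping.lookup
      (\<Sum>u\<in>Poly_Mapping.keys f. kscale (Poly_Mapping.lookup f u) (kmono u)) w" by simp
qed

text \<open>The case \<open>mono\<close> is restricted to words in the support of \<open>f\<close>,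
  so that facts about the support, such as its degrees, are available there.\<close>

lemma kmono_keys_induct [case_names zero mono add scale]:
  fixes f :: "'x bword \<Rightarrow>\<^sub>0 'k::comm_ring_1"
  assumes zero: "P 0"
    and mono: "\<And>w. w \<in> Poly_Mapping.keys f \<Longrightarrow> P (kmono w)"
    and add: "\<And>g h. P g \<Longrightarrow> P h \<Longrightarrow> P (g + h)"
    and scale: "\<And>c g. P g \<Longrightarrow> P (kscale c g)"
  shows "P f"
proof -
  have "P (\<Sum>u\<in>F. kscale (Poly_Mapping.lookup f u) (kmono u))"
    if "F \<subseteq> Poly_Mapping.keys f" "finite F" for F
    using that(2,1) by (induction F rule: finite_induct) (auto intro: zero add scale mono)
  then show ?thesis
    using kmono_expansion[of f] by (metis order_refl finite_keys)
qed

section \<open>Linear extension of maps on words, the common source of all operations on the free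
  module\<close>

definition klin :: "('x bword \<Rightarrow> ('y bword \<Rightarrow>\<^sub>0 'k)) \<Rightarrow> ('x bword \<Rightarrow>\<^sub>0 'k::comm_ring_1) \<Rightarrow> ('y bword \<Rightarrow>\<^sub>0 'k)"
  where "klin \<phi> f = (\<Sum>u\<in>Poly_Mapping.keys f. kscale (Poly_Mapping.lookup f u) (\<phi> u))"

text \<open>Words outside the support contribute zero, so \<open>f\<close>, \<open>g\<close> and
  \<open>f + g\<close> can be summed over one common index set.\<close>

lemma klin_superset:
  assumes "finite F" "Poly_Mapping.keys f \<subseteq> F"
  shows "klin \<phi> f = (\<Sum>u\<in>F. kscale (Poly_Mapping.lookup f u) (\<phi> u))"
  unfolding klin_def using assms by (intro sum.mono_neutral_left) (auto simp: in_keys_iff)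

lemma klin_zero [simp]: "klin \<phi> 0 = 0"
  by (simp add: klin_def)

lemma klin_add: "klin \<phi> (f + g) = klin \<phi> f + klin \<phi> g"
proof -
  let ?F = "Poly_Mapping.keys f \<union> Poly_Mapping.keys g"
  have "klin \<phi> h = (\<Sum>u\<in>?F. kscale (Poly_Mapping.lookup h u) (\<phi> u))" if "h \<in> {f, g, f + g}" for h
    using that keys_add[of f g] by (intro klin_superset) auto
  then show ?thesis
    by (simp add: lookup_add kscale_add_left sum.distrib)
qed

lemma klin_kscale: "klin \<phi> (kscale c f) = kscale c (klin \<phi> f)"
  using klin_superset[OF finite_keys keys_kscale, of \<phi> c f] by (simp add: klin_def kscale_sum)

lemma klin_uminus: "klin \<phi> (- f) = - klin \<phi> f"
  using klin_kscale[of \<phi> "- 1" f] by (simp add: kscale_minus_one)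

lemma klin_diff: "klin \<phi> (f - g) = klin \<phi> f - klin \<phi> g"
  using klin_add[of \<phi> f "- g"] by (simp add: klin_uminus)

lemma klin_kmono [simp]: "klin \<phi> (kmono w) = \<phi> w"
  by (simp add: klin_def lookup_kmono)

lemmas klin_linear = klin_add klin_diff klin_kscale

lemma klin_add_fun: "klin (\<lambda>u. \<phi> u + \<psi> u) f = klin \<phi> f + klin \<psi> f"
  by (simp add: klin_def kscale_add_right sum.distrib)

lemma klin_kscale_fun: "klin (\<lambda>u. kscale c (\<phi> u)) f = kscale c (klin \<phi> f)"
  by (simp add: klin_def kscale_sum mult.commute)

lemma kmul_klin: "kmul f g = klin (\<lambda>u. klin (\<lambda>v. kmono (u \<cdot> v)) g) f"
  by (simp add: kmul_def klin_def single_conv_kmono kscale_sum)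

lemma kbracket_klin: "kbracket = klin (\<lambda>u. kmono (bracket u))"
  by (rule ext) (simp add: kbracket_def klin_def single_conv_kmono)

lemma ksubst_klin: "ksubst q = klin (\<lambda>u. kmono (star_subst q u))"
  by (rule ext) (simp add: ksubst_def klin_def single_conv_kmono)

lemma kmul_kmono [simp]: "kmul (kmono u) (kmono v) = kmono (u \<cdot> v)"
  by (simp add: kmul_klin)

lemma kbracket_kmono [simp]: "kbracket (kmono u) = kmono (bracket u)"
  by (simp add: kbracket_klin)

lemma ksubst_kmono [simp]: "ksubst q (kmono u) = kmono (star_subst q u)"
  by (simp add: ksubst_klin)

lemma kmul_add_left: "kmul (f + g) h = kmul f h + kmul g h"
  by (simp add: kmul_klin klin_add)

lemma kmul_diff_left: "kmul (f - g) h = kmul f h - kmul g h"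
  by (simp add: kmul_klin klin_diff)

lemma kmul_kscale_left: "kmul (kscale c f) h = kscale c (kmul f h)"
  by (simp add: kmul_klin klin_kscale)

lemma kmul_add_right: "kmul h (f + g) = kmul h f + kmul h g"
  by (simp add: kmul_klin klin_add klin_add_fun)

lemma kmul_kscale_right: "kmul h (kscale c f) = kscale c (kmul h f)"
  by (simp add: kmul_klin klin_kscale klin_kscale_fun)

lemma kmul_diff_right: "kmul h (f - g) = kmul h f - kmul h g"
  using kmul_add_right[of h f "- g"] kmul_kscale_right[of h "- 1" g] by (simp add: kscale_minus_one)

lemma kmul_zero [simp]: "kmul 0 f = 0" "kmul f 0 = 0"
  by (simp_all add: kmul_def)

lemmas kmul_linear = kmul_add_left kmul_add_right kmul_diff_left kmul_diff_right
  kmul_kscale_left kmul_kscale_right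

lemmas kbracket_linear = klin_linear[of "\<lambda>u. kmono (bracket u)", folded kbracket_klin]

lemmas ksubst_linear = klin_linear[of "\<lambda>u. kmono (star_subst q u)" for q, folded ksubst_klin]

lemmas kscale_linear = kscale_add_right kscale_diff_right

lemma bmul_assoc: "(u \<cdot> v) \<cdot> w = u \<cdot> v \<cdot> w"
  by (induction u) auto

lemma kmul_assoc: "kmul (kmul f g) h = kmul f (kmul g h)"
proof (induction f rule: kmono_keys_induct)
  case (mono u)
  show ?case
  proof (induction g rule: kmono_keys_induct)
    case (mono v)
    show ?case
      by (induction h rule: kmono_keys_induct) (simp_all add: bmul_assoc kmul_linear)
  qed (simp_all add: kmul_linear)
qed (simp_all add: kmul_linear)

lemma letters_bmul [simp]: "letters (u \<cdot> v) = letters u @ letters v"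
  by (induction u) auto

lemma bdeg_bmul [simp]: "bdeg (u \<cdot> v) = bdeg u + bdeg v"
  by (simp add: bdeg_def)

lemma letters_nonempty: "letters w \<noteq> []"
  and letters_prime_nonempty: "letters_prime p \<noteq> []"
  for w :: "'x bword" and p :: "'x bprime"
  by (induction w and p) auto

lemma bdeg_pos [simp]: "0 < bdeg w"
  by (simp add: bdeg_def letters_nonempty)

lemma bdeg_simps [simp]:
  "bdeg (bracket w) = bdeg w"
  "bdeg (Conc p w) = bdeg (Sing p) + bdeg w"
  by (simp_all add: bdeg_def)

section \<open>A Rota-Baxter operator on the free module\<close>

primrec head_depth :: "'x bword \<Rightarrow> nat" and head_depth_prime :: "'x bprime \<Rightarrow> nat" where
  "head_depth (Sing p) = head_depth_prime p"
| "head_depth (Conc p w) = head_depth_prime p"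
| "head_depth_prime (Letter x) = 0"
| "head_depth_prime (Brk w) = Suc (head_depth w)"

lemma head_depth_bmul [simp]: "head_depth (u \<cdot> v) = head_depth u"
  by (cases u) auto

text \<open>
  The test on degrees always succeeds, by \<open>bdeg_rb_word\<close> below; it is there because the
  termination proof cannot know the support of \<open>rb_word lam y\<close>.
\<close>

function (sequential) rb_word :: "'k::comm_ring_1 \<Rightarrow> 'x bword \<Rightarrow> ('x bword \<Rightarrow>\<^sub>0 'k)" where
  "rb_word lam (Conc (Brk x) y) = kmul (kmono (bracket x)) (rb_word lam y)
     - (\<Sum>m\<in>Poly_Mapping.keys (rb_word lam y). if bdeg m = bdeg y
          then kscale (Poly_Mapping.lookup (rb_word lam y) m) (rb_word lam (x \<cdot> m)) else 0)
     - kscale lam (rb_word lam (x \<cdot> y))"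
| "rb_word lam w = kmono (bracket w)"
  by pat_completeness auto

termination
  \<comment> \<open>The call on \<open>y\<close> lowers the degree. The calls on
    \<open>x \<cdot> m\<close> and \<open>x \<cdot> y\<close> keep it, but the bracket around
    \<open>x\<close> is gone.\<close>
  by (relation "inv_image (less_than <*lex*> less_than) (\<lambda>(_, w). (bdeg w, head_depth w))") auto

lemma klin_klin: "klin \<phi> (klin \<psi> f) = klin (\<lambda>u. klin \<phi> (\<psi> u)) f"
  by (induction f rule: kmono_keys_induct) (simp_all add: klin_linear)

lemma keys_klin: "Poly_Mapping.keys (klin \<phi> f) \<subseteq> (\<Union>u\<in>Poly_Mapping.keys f. Poly_Mapping.keys (\<phi> u))"
proof
  fix w assume "w \<in> Poly_Mapping.keys (klin \<phi> f)"
  then have "(\<Sum>u\<in>Poly_Mapping.keys f. Poly_Mapping.lookup f u * Poly_Mapping.lookup (\<phi> u) w) \<noteq> 0"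
    by (simp add: in_keys_iff klin_def lookup_sum)
  then obtain u where "u \<in> Poly_Mapping.keys f" "Poly_Mapping.lookup f u * Poly_Mapping.lookup (\<phi> u) w \<noteq> 0"
    by (meson sum.not_neutral_contains_not_neutral)
  then show "w \<in> (\<Union>u\<in>Poly_Mapping.keys f. Poly_Mapping.keys (\<phi> u))"
    by (auto simp: in_keys_iff intro!: bexI[of _ u])
qed

lemma keys_kmul:
  "Poly_Mapping.keys (kmul f g) \<subseteq> {u \<cdot> v | u v. u \<in> Poly_Mapping.keys f \<and> v \<in> Poly_Mapping.keys g}"
proof -
  have "Poly_Mapping.keys (klin (\<lambda>v. kmono (u \<cdot> v) :: _ \<Rightarrow>\<^sub>0 'k) g) \<subseteq> {u \<cdot> v | v. v \<in> Poly_Mapping.keys g}"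
    for u and g :: "_ \<Rightarrow>\<^sub>0 'k::comm_ring_1"
    using keys_klin[of "\<lambda>v. kmono (u \<cdot> v) :: _ \<Rightarrow>\<^sub>0 'k" g] by auto
  then show ?thesis
    unfolding kmul_klin using keys_klin[of "\<lambda>u. klin (\<lambda>v. kmono (u \<cdot> v)) g" f] by fastforce
qed

lemma keys_minus_subset: "Poly_Mapping.keys (f - g) \<subseteq> Poly_Mapping.keys f \<union> Poly_Mapping.keys (g :: _ \<Rightarrow>\<^sub>0 'k::ab_group_add)"
  by (auto simp: in_keys_iff lookup_minus)

definition rb_oper :: "'k::comm_ring_1 \<Rightarrow> ('x bword \<Rightarrow>\<^sub>0 'k) \<Rightarrow> ('x bword \<Rightarrow>\<^sub>0 'k)" where
  "rb_oper lam = klin (rb_word lam)"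

lemmas rb_oper_linear = klin_linear[of "rb_word lam" for lam, folded rb_oper_def]

lemma rb_oper_kmono [simp]: "rb_oper lam (kmono w) = rb_word lam w"
  by (simp add: rb_oper_def)

lemma rb_oper_zero [simp]: "rb_oper lam 0 = 0"
  by (simp add: rb_oper_def)

text \<open>Identifies the sum over the support in the recursion of \<open>rb_word\<close> as one
  application of \<open>rb_oper\<close>.\<close>

lemma rb_oper_kmul_kmono: "rb_oper lam (kmul (kmono x) g) = klin (\<lambda>m. rb_word lam (x \<cdot> m)) g"
  by (simp add: rb_oper_def kmul_klin klin_klin)

text \<open>The conditional form is needed first: \<open>bdeg_rb_word\<close>, which discharges the
  hypothesis, is itself proved from the recursion without the degree test.\<close>

lemma rb_word_Conc_if:
  assumes "\<And>m. m \<in> Poly_Mapping.keys (rb_word lam y) \<Longrightarrow> bdeg m = bdeg y"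
  shows "rb_word lam (Conc (Brk x) y) = kmul (kmono (bracket x)) (rb_word lam y)
    - rb_oper lam (kmul (kmono x) (rb_word lam y)) - kscale lam (rb_word lam (x \<cdot> y))"
  unfolding rb_oper_kmul_kmono klin_def rb_word.simps using assms by simp

lemma rb_word_bracket: "\<nexists>x y. w = Conc (Brk x) y \<Longrightarrow> rb_word lam w = kmono (bracket w)"
  by (metis bword.exhaust bprime.exhaust rb_word.simps(2,3))

text \<open>Follows the recursion of \<open>rb_word\<close>, with the same measure as its
  termination proof, but lets \<open>m\<close> range over all words of the degree of
  \<open>y\<close>. The call on \<open>x \<cdot> y\<close> is the instance
  \<open>m = y\<close>.\<close>

lemma rewriting_induct [case_names rewrite bracket]:
  assumes "\<And>x y. P y \<Longrightarrow> (\<And>m. bdeg m = bdeg y \<Longrightarrow> P (x \<cdot> m)) \<Longrightarrow> P (Conc (Brk x) y)"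
    and "\<And>w. \<nexists>x y. w = Conc (Brk x) y \<Longrightarrow> P w"
  shows "P w"
proof (induction w rule: wf_induct_rule[OF wf_measures, of "[bdeg, head_depth]"])
  case (1 w)
  show ?case
  proof (cases "\<exists>x y. w = Conc (Brk x) y")
    case True
    then obtain x y where "w = Conc (Brk x) y" by blast
    with 1 show ?thesis using assms(1)[of y x] by simp
  qed (use assms(2) in blast)
qed

text \<open>Traces each word of P(\<lfloor>x\<rfloor>y) back to one of the three terms of the
  recursion. Homogeneity and irreducibility of the support both follow from this by
  induction.\<close>

lemma rb_word_support:
  assumes y: "\<And>v. v \<in> Poly_Mapping.keys (rb_word lam y) \<Longrightarrow> bdeg v = bdeg y"
    and m: "m \<in> Poly_Mapping.keys (rb_word lam (Conc (Brk x) y))"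
  shows "(\<exists>v\<in>Poly_Mapping.keys (rb_word lam y). m = bracket x \<cdot> v \<or> m \<in> Poly_Mapping.keys (rb_word lam (x \<cdot> v)))
    \<or> m \<in> Poly_Mapping.keys (rb_word lam (x \<cdot> y))"
proof -
  let ?A = "kmul (kmono (bracket x)) (rb_word lam y)"
  let ?B = "klin (\<lambda>v. rb_word lam (x \<cdot> v)) (rb_word lam y)"
  let ?C = "kscale lam (rb_word lam (x \<cdot> y))"
  have eq: "rb_word lam (Conc (Brk x) y) = ?A - ?B - ?C"
    using rb_word_Conc_if[OF y] by (simp add: rb_oper_kmul_kmono)
  have "m \<in> Poly_Mapping.keys ?A \<union> Poly_Mapping.keys ?B \<union> Poly_Mapping.keys ?C"
    using m keys_minus_subset[of "?A - ?B" ?C] keys_minus_subset[of ?A ?B] unfolding eq by blast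
  moreover have "m \<in> Poly_Mapping.keys ?A \<Longrightarrow> \<exists>v\<in>Poly_Mapping.keys (rb_word lam y). m = bracket x \<cdot> v"
    using keys_kmul[of "kmono (bracket x)" "rb_word lam y"] by auto
  moreover have "m \<in> Poly_Mapping.keys ?B \<Longrightarrow>
      \<exists>v\<in>Poly_Mapping.keys (rb_word lam y). m \<in> Poly_Mapping.keys (rb_word lam (x \<cdot> v))"
    using keys_klin[of "\<lambda>v. rb_word lam (x \<cdot> v)" "rb_word lam y"] by blast
  moreover have "m \<in> Poly_Mapping.keys ?C \<Longrightarrow> m \<in> Poly_Mapping.keys (rb_word lam (x \<cdot> y))"
    using keys_kscale by blast
  ultimately show ?thesis by blast
qed

lemma bdeg_rb_word: "m \<in> Poly_Mapping.keys (rb_word lam w) \<Longrightarrow> bdeg m = bdeg w"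
proof (induction w arbitrary: m rule: rewriting_induct)
  case (rewrite x y)
  have *: "bdeg m = bdeg x + bdeg v" if "bdeg v = bdeg y" "m \<in> Poly_Mapping.keys (rb_word lam (x \<cdot> v))" for v
    using rewrite.IH(2)[OF that] by simp
  from rb_word_support[OF rewrite.IH(1) rewrite.prems] show ?case
    using rewrite.IH(1) * by fastforce
qed (simp add: rb_word_bracket)

lemma rb_word_Conc:
  "rb_word lam (Conc (Brk x) y) = kmul (kmono (bracket x)) (rb_word lam y)
     - rb_oper lam (kmul (kmono x) (rb_word lam y)) - kscale lam (rb_word lam (x \<cdot> y))"
  by (rule rb_word_Conc_if) (rule bdeg_rb_word)

declare rb_word.simps(1) [simp del]

text \<open>Both sides are linear in \<open>g\<close>, and on words this is the recursion
  \<open>rb_word_Conc\<close>.\<close>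

lemma rb_oper_bracket_kmul:
  "rb_oper lam (kmul (kmono (bracket x)) g) = kmul (kmono (bracket x)) (rb_oper lam g)
     - rb_oper lam (kmul (kmono x) (rb_oper lam g)) - kscale lam (rb_oper lam (kmul (kmono x) g))"
  by (induction g rule: kmono_keys_induct,
    simp_all add: rb_word_Conc rb_oper_linear kmul_linear kscale_linear,
    simp_all (no_asm) add: algebra_simps)

section \<open>The Rota-Baxter identity for \<open>rb_oper\<close>\<close>

definition rb_identity :: "'k::comm_ring_1 \<Rightarrow> ('x bword \<Rightarrow>\<^sub>0 'k) \<Rightarrow> ('x bword \<Rightarrow>\<^sub>0 'k) \<Rightarrow> bool" where
  "rb_identity lam f g \<longleftrightarrow> kmul (rb_oper lam f) (rb_oper lam g) =
     rb_oper lam (kmul (rb_oper lam f) g) + rb_oper lam (kmul f (rb_oper lam g))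
       + kscale lam (rb_oper lam (kmul f g))"

lemma rb_identity_left:
  assumes "\<And>m. m \<in> Poly_Mapping.keys f \<Longrightarrow> rb_identity lam (kmono m) g"
  shows "rb_identity lam f g"
proof (induction f rule: kmono_keys_induct)
  case (mono w)
  then show ?case by (rule assms)
qed (simp_all add: rb_identity_def rb_oper_linear kmul_linear kscale_linear mult.commute)

lemma rb_identity_right:
  assumes "\<And>m. m \<in> Poly_Mapping.keys g \<Longrightarrow> rb_identity lam f (kmono m)"
  shows "rb_identity lam f g"
proof (induction g rule: kmono_keys_induct)
  case (mono w)
  then show ?case by (rule assms)
qed (simp_all add: rb_identity_def rb_oper_linear kmul_linear kscale_linear mult.commute)

text \<open>Write P for \<open>rb_oper lam\<close>. The recursion turns P(\<lfloor>x\<rfloor>g)P(h)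
  into \<lfloor>x\<rfloor>P(g)P(h) - P(xP(g))P(h) - \<lambda>P(xg)P(h), and each product is expanded
  by one hypothesis. On the other side P(\<lfloor>x\<rfloor>P(g)h), P(\<lfloor>x\<rfloor>gP(h)) and
  P(\<lfloor>x\<rfloor>gh) are expanded by the recursion. The terms P(xP(P(g)h)), P(xP(gP(h))) and
  \<lambda>P(xP(gh)) that remain add up to P(xP(g)P(h)), by the identity for \<open>g\<close> and
  \<open>h\<close> once more.\<close>

lemma rb_identity_bracket_kmul:
  assumes "rb_identity lam g h" "rb_identity lam (kmul (kmono x) (rb_oper lam g)) h"
    "rb_identity lam (kmul (kmono x) g) h"
  shows "rb_identity lam (kmul (kmono (bracket x)) g) h"
  using assms unfolding rb_identity_def
  by (simp only: rb_oper_bracket_kmul kmul_assoc rb_oper_linear kmul_linear kscale_linear)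
    (simp (no_asm) add: algebra_simps)

text \<open>Induction on \<open>a\<close> alone, along the recursion. If \<open>a\<close> is not of
  the form \<lfloor>x\<rfloor>y, then P(a) = \<lfloor>a\<rfloor> and the identity is the recursion
  for P(\<lfloor>a\<rfloor>b). Otherwise the support of xP(y) consists of words
  \<open>x \<cdot> m\<close> with \<open>m\<close> of the degree of \<open>y\<close>, which the
  induction hypothesis covers.\<close>

lemma rb_identity_kmono: "rb_identity lam (kmono a) (kmono b)"
proof (induction a rule: rewriting_induct)
  case (rewrite x y)
  have "rb_identity lam (kmul (kmono x) (rb_word lam y)) (kmono b)"
  proof (rule rb_identity_left)
    fix m assume "m \<in> Poly_Mapping.keys (kmul (kmono x) (rb_word lam y))"
    then obtain m' where "m = x \<cdot> m'" "m' \<in> Poly_Mapping.keys (rb_word lam y)"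
      using keys_kmul[of "kmono x" "rb_word lam y"] by auto
    then show "rb_identity lam (kmono m) (kmono b)"
      using rewrite.IH(2) by (simp add: bdeg_rb_word)
  qed
  with rewrite.IH(1) rewrite.IH(2)[of y]
  have "rb_identity lam (kmul (kmono (bracket x)) (kmono y)) (kmono b)"
    by (intro rb_identity_bracket_kmul) simp_all
  then show ?case by simp
next
  case (bracket w)
  then show ?case by (simp add: rb_identity_def rb_word_bracket rb_word_Conc)
qed

lemma rb_oper_rota_baxter: "rb_identity lam f g"
  by (rule rb_identity_left, rule rb_identity_right, rule rb_identity_kmono)

section \<open>Irreducible words and normal forms\<close>

text \<open>A form of \<open>Irr_rbl\<close> suited to structural induction: the pattern is tested
  at every bracket. \<open>Irr_rbl_eq\<close> proves the agreement.\<close>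

primrec irreducible_word :: "'x bword \<Rightarrow> bool" and irreducible_prime :: "'x bprime \<Rightarrow> bool" where
  "irreducible_word (Sing p) = irreducible_prime p"
| "irreducible_word (Conc p w) = (irreducible_prime p \<and> irreducible_word w)"
| "irreducible_prime (Letter x) = True"
| "irreducible_prime (Brk w) = (irreducible_word w \<and> (\<nexists>x y. w = bracket x \<cdot> y))"

lemma irreducible_bmul [simp]: "irreducible_word (u \<cdot> v) \<longleftrightarrow> irreducible_word u \<and> irreducible_word v"
  by (induction u) auto

lemma letters_map_bword: "letters (map_bword f w) = map f (letters w)"
  and letters_map_bprime: "letters_prime (map_bprime f p) = map f (letters_prime p)"
  for w :: "'x bword" and p :: "'x bprime"
  by (induction w and p) auto

text \<open>\<open>map_bword Some\<close> embeds ordinary words as contexts without \<star>; the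
  side factors of all contexts built below have this form.\<close>

lemma star_subst_map_Some [simp]: "star_subst (map_bword Some w) u = w"
  and star_subst_prime_map_Some [simp]: "star_subst_prime (map_bprime Some p) u = Sing p"
  for w :: "'x bword" and p :: "'x bprime"
  by (induction w and p) auto

lemma star_subst_bmul [simp]: "star_subst (q \<cdot> r) u = star_subst q u \<cdot> star_subst r u"
  by (induction q) (auto simp: bmul_assoc)

lemma count_letters_map_Some [simp]: "count_list (letters (map_bword Some w)) None = 0"
  by (simp add: letters_map_bword count_list_0_iff)

lemma star_words_bmul_left: "q \<in> star_words \<Longrightarrow> q \<cdot> map_bword Some w \<in> star_words"
  and star_words_Conc: "q \<in> star_words \<Longrightarrow> Conc (map_bprime Some p) q \<in> star_words"
  and star_words_bracket: "q \<in> star_words \<Longrightarrow> bracket q \<in> star_words"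
  and star_words_star: "bletter None \<in> star_words"
  by (auto simp: star_words_def letters_map_bprime count_list_0_iff)

text \<open>A product or bracket is irreducible only if its parts are, so a reducible word spoils
  everything around it. Asking merely for an occurrence of \<star>, rather than exactly one, passes
  directly to the part that contains it.\<close>

lemma reducible_star_subst:
  fixes q :: "'x option bword" and p :: "'x option bprime"
  assumes "\<not> irreducible_word v"
  shows "None \<in> set (letters q) \<Longrightarrow> \<not> irreducible_word (star_subst q v)"
    and "None \<in> set (letters_prime p) \<Longrightarrow> \<not> irreducible_word (star_subst_prime p v)"
  using assms by (induction q and p) auto

text \<open>The induction descends to an offending bracket and records the way back as a
  context.\<close>

lemma reducible_cases:
  fixes w :: "'x bword" and p :: "'x bprime"
  shows "\<not> irreducible_word w \<Longrightarrow> \<exists>q\<in>star_words. \<exists>x y. w = star_subst q (bracket (bracket x \<cdot> y))"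
    and "\<not> irreducible_prime p \<Longrightarrow> \<exists>q\<in>star_words. \<exists>x y. Sing p = star_subst q (bracket (bracket x \<cdot> y))"
proof (induction w and p)
  case (Conc p w)
  show ?case
  proof (cases "irreducible_prime p")
    case False
    then obtain q x y where "q \<in> star_words" "star_subst q (bracket (bracket x \<cdot> y)) = Sing p"
      using Conc by metis
    then have "q \<cdot> map_bword Some w \<in> star_words"
      "Conc p w = star_subst (q \<cdot> map_bword Some w) (bracket (bracket x \<cdot> y))"
      by (simp_all add: star_words_bmul_left)
    then show ?thesis by blast
  next
    case True
    then obtain q x y where "q \<in> star_words" "w = star_subst q (bracket (bracket x \<cdot> y))"
      using Conc by auto
    then have "Conc (map_bprime Some p) q \<in> star_words"
      "Conc p w = star_subst (Conc (map_bprime Some p) q) (bracket (bracket x \<cdot> y))"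
      by (simp_all add: star_words_Conc)
    then show ?thesis by blast
  qed
next
  case (Brk w)
  show ?case
  proof (cases "irreducible_word w")
    case False
    then obtain q x y where "q \<in> star_words" "w = star_subst q (bracket (bracket x \<cdot> y))"
      using Brk by blast
    then have "bracket q \<in> star_words"
      "bracket w = star_subst (bracket q) (bracket (bracket x \<cdot> y))"
      by (simp_all add: star_words_bracket)
    then show ?thesis by blast
  next
    case True
    then obtain x y where "w = bracket x \<cdot> y"
      using Brk by auto
    then have "bracket w = star_subst (bletter None) (bracket (bracket x \<cdot> y))"
      by simp
    then show ?thesis using star_words_star by blast
  qed
qed auto

lemma Irr_rbl_eq: "(Irr_rbl :: 'x bword set) = Collect irreducible_word"
proof (intro equalityI subsetI)
  fix w :: "'x bword"
  assume "w \<in> Irr_rbl"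
  then show "w \<in> Collect irreducible_word"
    using reducible_cases(1)[of w] unfolding Irr_rbl_def by blast
next
  fix w :: "'x bword"
  assume w: "w \<in> Collect irreducible_word"
  have False if "w = star_subst q (bracket (bracket x \<cdot> y))" "q \<in> star_words" for q x y
  proof -
    have "None \<in> set (letters q)"
      using that(2) count_list_0_iff[of "letters q" None] by (auto simp: star_words_def)
    then have "\<not> irreducible_word (star_subst q (bracket (bracket x \<cdot> y)))"
      by (rule reducible_star_subst(1)[rotated]) auto
    then show False using w that(1) by simp
  qed
  then show "w \<in> Irr_rbl"
    unfolding Irr_rbl_def by blast
qed

section \<open>The operated homomorphism N of the overview and its values\<close>

primrec normal_form :: "'k::comm_ring_1 \<Rightarrow> 'x bword \<Rightarrow> ('x bword \<Rightarrow>\<^sub>0 'k)"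
  and normal_form_prime :: "'k::comm_ring_1 \<Rightarrow> 'x bprime \<Rightarrow> ('x bword \<Rightarrow>\<^sub>0 'k)" where
  "normal_form lam (Sing p) = normal_form_prime lam p"
| "normal_form lam (Conc p w) = kmul (normal_form_prime lam p) (normal_form lam w)"
| "normal_form_prime lam (Letter x) = kmono (bletter x)"
| "normal_form_prime lam (Brk w) = rb_oper lam (normal_form lam w)"

lemma normal_form_bmul: "normal_form lam (u \<cdot> v) = kmul (normal_form lam u) (normal_form lam v)"
  by (induction u) (simp_all add: kmul_assoc)

definition knormal :: "'k::comm_ring_1 \<Rightarrow> ('x bword \<Rightarrow>\<^sub>0 'k) \<Rightarrow> ('x bword \<Rightarrow>\<^sub>0 'k)" where
  "knormal lam = klin (normal_form lam)"

lemmas knormal_linear = klin_linear[of "normal_form lam" for lam, folded knormal_def]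

lemma knormal_kmono [simp]: "knormal lam (kmono w) = normal_form lam w"
  by (simp add: knormal_def)

lemma knormal_zero [simp]: "knormal lam 0 = 0"
  by (simp add: knormal_def)

lemma kbracket_zero [simp]: "kbracket 0 = 0"
  by (simp add: kbracket_klin)

lemma knormal_kmul: "knormal lam (kmul f g) = kmul (knormal lam f) (knormal lam g)"
proof (induction f rule: kmono_keys_induct)
  case (mono u)
  show ?case
    by (induction g rule: kmono_keys_induct) (simp_all add: normal_form_bmul kmul_linear knormal_linear)
qed (simp_all add: kmul_linear knormal_linear)

lemma knormal_kbracket: "knormal lam (kbracket f) = rb_oper lam (knormal lam f)"
  by (induction f rule: kmono_keys_induct) (simp_all add: kbracket_linear knormal_linear rb_oper_linear)

text \<open>The defining relation as a bilinear expression in arbitrary elements. This allows linear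
  combinations to be inserted for \<open>x\<close> and \<open>y\<close>, as the nested compositions
  require.\<close>

definition rb_relation :: "'k::comm_ring_1 \<Rightarrow> ('x bword \<Rightarrow>\<^sub>0 'k) \<Rightarrow> ('x bword \<Rightarrow>\<^sub>0 'k) \<Rightarrow> ('x bword \<Rightarrow>\<^sub>0 'k)" where
  "rb_relation lam f g = kbracket (kmul (kbracket f) g) + kbracket (kmul f (kbracket g))
     + kscale lam (kbracket (kmul f g)) - kmul (kbracket f) (kbracket g)"

lemma S_rbl_eq: "S_rbl lam = {rb_relation lam (kmono x) (kmono y) | x y. True}"
  by (simp add: S_rbl_def rb_relation_def)

text \<open>N respects products and turns the bracket into P, so the relation becomes the
  Rota-Baxter identity for P at the images of \<open>f\<close> and \<open>g\<close>.\<close>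

lemma knormal_rb_relation: "knormal lam (rb_relation lam f g) = 0"
  using rb_oper_rota_baxter[of lam "knormal lam f" "knormal lam g"]
  by (simp add: rb_relation_def rb_identity_def knormal_linear knormal_kmul knormal_kbracket)

text \<open>If \<lfloor>x\<rfloor>y is irreducible, so are \<lfloor>x\<rfloor>, \<open>x\<close> and
  \<open>y\<close>, hence all words to which the recursion applies P. In the base case
  \<lfloor>w\<rfloor> creates no forbidden bracket, since \<open>w\<close> does not have the form
  \<lfloor>x\<rfloor>y.\<close>

lemma irreducible_rb_word:
  "irreducible_word w \<Longrightarrow> m \<in> Poly_Mapping.keys (rb_word lam w) \<Longrightarrow> irreducible_word m"
proof (induction w arbitrary: m rule: rewriting_induct)
  case (rewrite x y)
  have irr: "irreducible_word x" "irreducible_word y" "irreducible_word (bracket x)"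
    using rewrite.prems(1) by auto
  have *: "irreducible_word m"
    if "bdeg v = bdeg y" "irreducible_word v" "m \<in> Poly_Mapping.keys (rb_word lam (x \<cdot> v))" for v
    using rewrite.IH(2)[OF that(1) _ that(3)] irr that(2) by simp
  have "(\<exists>v\<in>Poly_Mapping.keys (rb_word lam y). m = bracket x \<cdot> v \<or> m \<in> Poly_Mapping.keys (rb_word lam (x \<cdot> v)))
      \<or> m \<in> Poly_Mapping.keys (rb_word lam (x \<cdot> y))"
    by (rule rb_word_support[OF _ rewrite.prems(2)]) (rule bdeg_rb_word)
  then show ?case
    using rewrite.IH(1)[OF irr(2)] irr * bdeg_rb_word irreducible_bmul by blast
qed (auto simp: rb_word_bracket)

lemma irreducible_normal_form:
  fixes w :: "'x bword" and p :: "'x bprime"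
  shows "Poly_Mapping.keys (normal_form lam w) \<subseteq> Collect irreducible_word"
    and "Poly_Mapping.keys (normal_form_prime lam p) \<subseteq> Collect irreducible_word"
proof (induction w and p)
  case (Conc p w)
  then have "{u \<cdot> v | u v. u \<in> Poly_Mapping.keys (normal_form_prime lam p) \<and> v \<in> Poly_Mapping.keys (normal_form lam w)}
      \<subseteq> Collect irreducible_word" by auto
  with keys_kmul show ?case by fastforce
next
  case (Brk w)
  then show ?case
    using keys_klin[of "rb_word lam" "normal_form lam w"] irreducible_rb_word[of _ _ lam]
    by (fastforce simp: rb_oper_def)
qed auto

lemma irreducible_knormal: "Poly_Mapping.keys (knormal lam f) \<subseteq> Collect irreducible_word"
  using keys_klin[of "normal_form lam" f] irreducible_normal_form(1) unfolding knormal_def by blast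

text \<open>In an irreducible word no bracket has content \<lfloor>x\<rfloor>y, so each application
  of P just adds the bracket.\<close>

lemma normal_form_irreducible:
  fixes w :: "'x bword" and p :: "'x bprime"
  shows "irreducible_word w \<Longrightarrow> normal_form lam w = kmono w"
    and "irreducible_prime p \<Longrightarrow> normal_form_prime lam p = kmono (Sing p)"
  by (induction w and p) (simp_all add: rb_word_bracket)

lemma knormal_irreducible:
  "Poly_Mapping.keys f \<subseteq> Collect irreducible_word \<Longrightarrow> knormal lam f = f"
  unfolding knormal_def klin_def
  by (subst (2) kmono_expansion[of f], rule sum.cong) (auto simp: normal_form_irreducible)

section \<open>Operated ideals, and the congruence of N with the identity modulo the
  relations\<close>

definition kideal :: "('x bword \<Rightarrow>\<^sub>0 'k::comm_ring_1) set \<Rightarrow> bool" where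
  "kideal I \<longleftrightarrow> 0 \<in> I \<and> (\<forall>f\<in>I. \<forall>g\<in>I. f + g \<in> I) \<and> (\<forall>c. \<forall>f\<in>I. kscale c f \<in> I)
     \<and> (\<forall>a. \<forall>f\<in>I. kmul a f \<in> I \<and> kmul f a \<in> I) \<and> (\<forall>f\<in>I. kbracket f \<in> I)"

lemma kidealD:
  assumes "kideal I"
  shows "0 \<in> I" "f \<in> I \<Longrightarrow> g \<in> I \<Longrightarrow> f + g \<in> I" "f \<in> I \<Longrightarrow> kscale c f \<in> I"
    "f \<in> I \<Longrightarrow> kmul a f \<in> I" "f \<in> I \<Longrightarrow> kmul f a \<in> I" "f \<in> I \<Longrightarrow> kbracket f \<in> I"
    "f \<in> I \<Longrightarrow> - f \<in> I" "f \<in> I \<Longrightarrow> g \<in> I \<Longrightarrow> f - g \<in> I"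
proof -
  show "0 \<in> I" "f \<in> I \<Longrightarrow> g \<in> I \<Longrightarrow> f + g \<in> I" "f \<in> I \<Longrightarrow> kscale c f \<in> I"
    "f \<in> I \<Longrightarrow> kmul a f \<in> I" "f \<in> I \<Longrightarrow> kmul f a \<in> I" "f \<in> I \<Longrightarrow> kbracket f \<in> I" for f g
    using assms by (auto simp: kideal_def)
  show minus: "f \<in> I \<Longrightarrow> - f \<in> I" for f
    using assms kscale_minus_one[of f] by (metis kideal_def)
  show "f \<in> I \<Longrightarrow> g \<in> I \<Longrightarrow> f - g \<in> I"
    using minus[of g] assms unfolding kideal_def by (metis diff_conv_add_uminus)
qed

lemma knormal_kernel_kideal: "kideal {f. knormal lam f = 0}"
  by (simp add: kideal_def knormal_linear knormal_kmul knormal_kbracket)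

lemma rb_oper_cong_kbracket:
  assumes "kideal I" "\<And>m. m \<in> Poly_Mapping.keys f \<Longrightarrow> rb_word lam m - kmono (bracket m) \<in> I"
  shows "rb_oper lam f - kbracket f \<in> I"
proof (induction f rule: kmono_keys_induct)
  case zero
  then show ?case using kidealD(1)[OF assms(1)] by simp
next
  case (add g h)
  then show ?case using kidealD(2)[OF assms(1), of "rb_oper lam g - kbracket g" "rb_oper lam h - kbracket h"]
    by (simp add: rb_oper_linear kbracket_linear algebra_simps)
next
  case (scale c g)
  then show ?case using kidealD(3)[OF assms(1), of "rb_oper lam g - kbracket g" c]
    by (simp add: rb_oper_linear kbracket_linear kscale_linear)
qed (simp add: assms(2))

lemma rb_word_cong_bracket:
  assumes I: "kideal I" "S_rbl lam \<subseteq> I"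
  shows "rb_word lam w - kmono (bracket w) \<in> I"
proof (induction w rule: rewriting_induct)
  case (rewrite x y)
  let ?Py = "rb_word lam y"
  let ?x = "kmono x"
  let ?y = "kmono y"
  note cong = rb_oper_cong_kbracket[OF I(1)]
  have y: "?Py - kbracket ?y \<in> I"
    using rewrite.IH(1) by simp
  have xy: "rb_word lam (x \<cdot> y) - kbracket (kmul ?x ?y) \<in> I"
    using rewrite.IH(2)[of y] by simp
  have xPy: "rb_oper lam (kmul ?x ?Py) - kbracket (kmul ?x ?Py) \<in> I"
  proof (rule cong)
    fix m assume "m \<in> Poly_Mapping.keys (kmul ?x ?Py)"
    then obtain m' where "m = x \<cdot> m'" "m' \<in> Poly_Mapping.keys ?Py"
      using keys_kmul[of ?x ?Py] by auto
    then show "rb_word lam m - kmono (bracket m) \<in> I"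
      using rewrite.IH(2)[of m'] by (simp add: bdeg_rb_word)
  qed
  have "rb_relation lam ?x ?y \<in> I"
    using I(2) by (auto simp: S_rbl_eq)
  \<comment> \<open>The first, second and fourth terms replace P by the bracket in the recursion for
    P(\<lfloor>x\<rfloor>y); the third repairs \<lfloor>xP(y)\<rfloor> to
    \<lfloor>x\<lfloor>y\<rfloor>\<rfloor>. What results differs from
    \<lfloor>\<lfloor>x\<rfloor>y\<rfloor> by the relation for \<open>x\<close> and
    \<open>y\<close>.\<close>
  then have "kmul (kbracket ?x) (?Py - kbracket ?y) - (rb_oper lam (kmul ?x ?Py) - kbracket (kmul ?x ?Py))
      - kbracket (kmul ?x (?Py - kbracket ?y)) - kscale lam (rb_word lam (x \<cdot> y) - kbracket (kmul ?x ?y))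
      - rb_relation lam ?x ?y \<in> I"
    by (rule kidealD(8)[OF I(1) kidealD(8)[OF I(1) kidealD(8)[OF I(1) kidealD(8)[OF I(1)]]],
          OF kidealD(4)[OF I(1) y] xPy kidealD(6)[OF I(1) kidealD(4)[OF I(1) y]] kidealD(3)[OF I(1) xy]])
  also have "kmul (kbracket ?x) (?Py - kbracket ?y) - (rb_oper lam (kmul ?x ?Py) - kbracket (kmul ?x ?Py))
      - kbracket (kmul ?x (?Py - kbracket ?y)) - kscale lam (rb_word lam (x \<cdot> y) - kbracket (kmul ?x ?y))
      - rb_relation lam ?x ?y = rb_word lam (Conc (Brk x) y) - kmono (bracket (Conc (Brk x) y))"
    by (simp add: rb_relation_def rb_word_Conc kmul_linear kbracket_linear kscale_linear)
  finally show ?case .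
qed (simp add: rb_word_bracket kidealD(1)[OF I(1)])

text \<open>For a product, N(p)N(w) - pw = (N(p) - p)N(w) + p(N(w) - w). For a bracket, P(N(w)) is
  first replaced by \<lfloor>N(w)\<rfloor>, and then N(w) by \<open>w\<close>.\<close>

lemma normal_form_cong:
  fixes w :: "'x bword" and p :: "'x bprime"
  assumes I: "kideal I" "S_rbl lam \<subseteq> I"
  shows "normal_form lam w - kmono w \<in> I"
    and "normal_form_prime lam p - kmono (Sing p) \<in> I"
proof (induction w and p)
  case (Conc p w)
  have "kmul (normal_form_prime lam p - kmono (Sing p)) (normal_form lam w)
      + kmul (kmono (Sing p)) (normal_form lam w - kmono w) \<in> I"
    using kidealD(5)[OF I(1) Conc(1)] kidealD(4)[OF I(1) Conc(2)] by (intro kidealD(2)[OF I(1)])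
  then show ?case by (simp add: kmul_linear)
next
  case (Brk w)
  have "(rb_oper lam (normal_form lam w) - kbracket (normal_form lam w))
      + kbracket (normal_form lam w - kmono w) \<in> I"
    using Brk by (intro kidealD(2,6)[OF I(1)] rb_oper_cong_kbracket rb_word_cong_bracket I)
  then show ?case by (simp add: kbracket_linear)
qed (use kidealD(1)[OF I(1)] in simp_all)

lemma knormal_cong:
  assumes I: "kideal I" "S_rbl lam \<subseteq> I"
  shows "knormal lam f - f \<in> I"
proof (induction f rule: kmono_keys_induct)
  case zero
  then show ?case using kidealD(1)[OF assms(1)] by simp
next
  case (mono w)
  show ?case using normal_form_cong(1)[OF I] by simp
next
  case (add g h)
  then show ?case using kidealD(2)[OF I(1), of "knormal lam g - g" "knormal lam h - h"]
    by (simp add: knormal_linear algebra_simps)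
next
  case (scale c g)
  then show ?case using kidealD(3)[OF I(1), of "knormal lam g - g" c]
    by (simp add: knormal_linear kscale_linear)
qed

section \<open>Compositions\<close>

lemma factor_paths_bmul [simp]: "factor_paths (u \<cdot> v) = factor_paths u @ factor_paths v"
  by (induction u) auto

lemma path_list_bmul [simp]: "path_list (u \<cdot> v) = map ((#) SymMu) (factor_paths u @ factor_paths v)"
  by (cases u) auto

lemma length_paths: "length (path_list w) = bdeg w" "length (factor_paths w) = bdeg w"
  "length (prime_paths p) = bdeg (Sing p)"
  for w :: "'x bword" and p :: "'x bprime"
  by (induction w and w and p rule: path_list_factor_paths_prime_paths.induct) (auto simp: bdeg_def)

lemma paths_nonempty [simp]: "path_list w \<noteq> []" "factor_paths w \<noteq> []" "prime_paths p \<noteq> []"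
  using length_paths bdeg_pos by (metis less_irrefl list.size(3))+

text \<open>The path of the first letter enters in two versions: for the word standing alone, and in
  \<open>head_factor_path_length\<close> for the word as part of a longer product, before the common
  \<mu> is added.\<close>

definition head_path_length :: "'x bword \<Rightarrow> nat" where
  "head_path_length w = length (hd (path_list w))"

definition head_factor_path_length :: "'x bword \<Rightarrow> nat" where
  "head_factor_path_length w = length (hd (factor_paths w))"

lemma head_path_length_simps [simp]:
  "head_path_length (Conc p w) = Suc (head_factor_path_length (Sing p))"
  "head_path_length (u \<cdot> v) = Suc (head_factor_path_length u)"
  "head_path_length (bracket u) = Suc (head_path_length u)"
  "head_factor_path_length (Conc p w) = head_factor_path_length (Sing p)"
  "head_factor_path_length (u \<cdot> v) = head_factor_path_length u"
  "head_factor_path_length (bracket u) = Suc (head_path_length u)"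
  by (simp_all add: head_path_length_def head_factor_path_length_def hd_map hd_append)

text \<open>The two lengths agree for a single prime and differ by one \<mu> for a product.\<close>

lemma head_factor_path_length_le: "head_factor_path_length w \<le> head_path_length w"
  by (cases w) (simp_all add: head_path_length_def head_factor_path_length_def hd_map hd_append)

text \<open>The first criterion of the degree lexicographical order alone; it is stable under
  prefixing one symbol to all paths.\<close>

definition shorter :: "('a list \<times> 'a list) set" where
  "shorter = {(a, b). length a < length b}"

text \<open>
  \<^const>\<open>pl_le\<close> is not compatible with the operations: \<open>\<lfloor>xy\<rfloor> < \<lfloor>x\<rfloor>\<lfloor>y\<rfloor>\<close>, but
  \<open>\<lfloor>x\<rfloor>\<lfloor>y\<rfloor>z < \<lfloor>xy\<rfloor>z\<close>. The following subrelation is compatible, and it suffices for all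
  comparisons below.
\<close>

definition path_less :: "'x bword \<Rightarrow> 'x bword \<Rightarrow> bool" where
  "path_less u v \<longleftrightarrow> (path_list u, path_list v) \<in> lex shorter \<and> (factor_paths u, factor_paths v) \<in> lex shorter"

lemma lex_map_Cons_shorter: "(as, bs) \<in> lex shorter \<Longrightarrow> (map ((#) x) as, map ((#) x) bs) \<in> lex shorter"
proof (induction as arbitrary: bs)
  case (Cons a as)
  then show ?case by (cases bs) (auto simp: shorter_def)
qed simp

lemma lex_shorter_hd:
  "length as = length bs \<Longrightarrow> as \<noteq> [] \<Longrightarrow> length (hd as) < length (hd bs) \<Longrightarrow> (as, bs) \<in> lex shorter"
  by (cases as; cases bs) (auto simp: shorter_def)

text \<open>The lexicographical comparison of the path lists is decided at the first letter.\<close>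

lemma path_less_head:
  assumes "bdeg u = bdeg v" "head_path_length u < head_path_length v"
    "head_factor_path_length u < head_factor_path_length v"
  shows "path_less u v"
  using assms unfolding path_less_def head_path_length_def head_factor_path_length_def
  by (auto intro!: lex_shorter_hd simp: length_paths)

text \<open>A product sees its factors through \<open>factor_paths\<close>, a bracket sees its
  content through \<open>path_list\<close>. Carrying both components of \<open>path_less\<close>
  therefore makes it stable under all operations.\<close>

lemma path_less_bmul_left: "path_less u v \<Longrightarrow> path_less (w \<cdot> u) (w \<cdot> v)"
  unfolding path_less_def by (auto intro!: lex_append_leftI lex_map_Cons_shorter)

lemma path_less_bmul_right: "path_less u v \<Longrightarrow> path_less (u \<cdot> w) (v \<cdot> w)"
  unfolding path_less_def by (auto intro!: lex_append_rightI lex_map_Cons_shorter simp: length_paths)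

lemma path_less_bracket: "path_less u v \<Longrightarrow> path_less (bracket u) (bracket v)"
  unfolding path_less_def by (auto intro!: lex_map_Cons_shorter)

lemma path_less_bdeg: "path_less u v \<Longrightarrow> bdeg u = bdeg v"
  by (auto simp: path_less_def lex_conv length_paths)

lemma star_subst_no_star:
  fixes q :: "'x option bword" and p :: "'x option bprime"
  shows "None \<notin> set (letters q) \<Longrightarrow> star_subst q u = star_subst q v"
    and "None \<notin> set (letters_prime p) \<Longrightarrow> star_subst_prime p u = star_subst_prime p v"
  by (induction q and p) (auto split: option.splits)

text \<open>Since \<star> occurs exactly once, one factor of a product changes and the other is the
  same on both sides.\<close>

lemma path_less_star_subst_aux:
  fixes q :: "'x option bword" and p :: "'x option bprime"
  assumes "path_less u v"
  shows "count_list (letters q) None = 1 \<Longrightarrow> path_less (star_subst q u) (star_subst q v)"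
    and "count_list (letters_prime p) None = 1 \<Longrightarrow> path_less (star_subst_prime p u) (star_subst_prime p v)"
proof (induction q and p)
  case (Conc p q)
  then consider "count_list (letters_prime p) None = 1" "count_list (letters q) None = 0"
    | "count_list (letters_prime p) None = 0" "count_list (letters q) None = 1"
    by fastforce
  then show ?case
  proof cases
    case 1
    then show ?thesis
      using Conc.IH star_subst_no_star(1)[of q u v]
      by (simp add: path_less_bmul_right count_list_0_iff)
  next
    case 2
    then show ?thesis
      using Conc.IH star_subst_no_star(2)[of p u v]
      by (simp add: path_less_bmul_left count_list_0_iff)
  qed
qed (use assms in \<open>auto simp: path_less_bracket split: option.splits if_splits\<close>)

lemma path_less_star_subst:
  "q \<in> star_words \<Longrightarrow> path_less u v \<Longrightarrow> path_less (star_subst q u) (star_subst q v)"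
  using path_less_star_subst_aux(1) by (auto simp: star_words_def)

lemma asym_symbol_less: "asym {(a :: 'x::linorder path_symbol, b). symbol_less a b}"
proof (rule asymI)
  fix a b :: "'x path_symbol"
  assume "(a, b) \<in> {(a, b). symbol_less a b}"
  then show "(b, a) \<notin> {(a, b). symbol_less a b}"
    by (cases a; cases b) auto
qed

text \<open>\<open>lenlex\<close> orders by length first, so it contains \<open>shorter\<close>;
  asymmetry of the resulting lexicographical order excludes the converse comparison.\<close>

lemma strict_part_path_less:
  fixes u v :: "'x::linorder bword"
  assumes "path_less u v"
  shows "strict_part pl_le u v"
proof -
  let ?R = "lenlex {(a :: 'x path_symbol, b). symbol_less a b}"
  have asym: "asym (lex ?R)"
    by (intro asym_lex asym_lenlex asym_symbol_less)
  have "shorter \<subseteq> ?R"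
    by (auto simp: shorter_def lenlex_conv)
  then have "lex shorter \<subseteq> lex ?R"
    unfolding lex_conv by blast
  then have less: "(path_list u, path_list v) \<in> lex ?R"
    using assms by (auto simp: path_less_def)
  moreover have "(path_list v, path_list u) \<notin> lex ?R" "path_list v \<noteq> path_list u"
    using less asym by (auto dest: asymD)
  ultimately show ?thesis
    using path_less_bdeg[OF assms] by (auto simp: strict_part_def pl_le_def pl_key_less_def)
qed

lemma path_less_irrefl: "\<not> path_less u (u :: 'x bword)"
proof -
  have "asym (shorter :: 'x path_symbol list rel)"
    by (auto simp: shorter_def intro: asymI)
  then have "asym (lex (shorter :: 'x path_symbol list rel))"
    by (rule asym_lex)
  then show ?thesis
    unfolding path_less_def by (auto dest: asymD)
qed

section \<open>Leading words of the relations inside contexts\<close>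

definition rb_rest :: "'k::comm_ring_1 \<Rightarrow> ('x bword \<Rightarrow>\<^sub>0 'k) \<Rightarrow> ('x bword \<Rightarrow>\<^sub>0 'k) \<Rightarrow> ('x bword \<Rightarrow>\<^sub>0 'k)" where
  "rb_rest lam f g = kmul (kbracket f) (kbracket g) - kbracket (kmul f (kbracket g))
     - kscale lam (kbracket (kmul f g))"

text \<open>\<open>rb_rest\<close> is what replaces \<lfloor>\<lfloor>f\<rfloor>g\<rfloor> when the
  relation is read as a rewriting rule.\<close>

lemma rb_relation_rest: "rb_relation lam f g = kbracket (kmul (kbracket f) g) - rb_rest lam f g"
  by (simp add: rb_relation_def rb_rest_def)

text \<open>In \<lfloor>\<lfloor>x\<rfloor>y\<rfloor> the first letter has the prefix P \<mu> P
  before its path in \<open>x\<close>. In \<lfloor>x\<rfloor>\<lfloor>y\<rfloor> the prefix is \<mu>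
  P; in \<lfloor>x\<lfloor>y\<rfloor>\<rfloor> and \<lfloor>xy\<rfloor> it is P \<mu>, followed by a
  path that is at most as long.\<close>

lemma path_less_rb_rest:
  assumes "m \<in> Poly_Mapping.keys (rb_rest lam (kmono x) (kmono y))"
  shows "path_less m (bracket (bracket x \<cdot> y))"
proof -
  have "m \<in> {bracket x \<cdot> bracket y, bracket (x \<cdot> bracket y), bracket (x \<cdot> y)}"
    using assms by (auto simp: rb_rest_def in_keys_iff lookup_minus lookup_kmono split: if_splits)
  then show ?thesis
    using head_factor_path_length_le[of x] by (auto intro!: path_less_head)
qed

lemma keys_ksubst: "Poly_Mapping.keys (ksubst q f) \<subseteq> star_subst q ` Poly_Mapping.keys f"
  using keys_klin[of "\<lambda>u. kmono (star_subst q u)" f] by (auto simp: ksubst_klin)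

lemma ksubst_zero [simp]: "ksubst q 0 = 0"
  by (simp add: ksubst_klin)

lemma path_less_ksubst_rb_rest:
  assumes "q \<in> star_words" "m \<in> Poly_Mapping.keys (ksubst q (rb_rest lam (kmono x) (kmono y)))"
  shows "path_less m (star_subst q (bracket (bracket x \<cdot> y)))"
proof -
  obtain m' where "m' \<in> Poly_Mapping.keys (rb_rest lam (kmono x) (kmono y))" "m = star_subst q m'"
    using assms(2) keys_ksubst by blast
  then show ?thesis
    using path_less_star_subst[OF assms(1) path_less_rb_rest] by blast
qed

text \<open>By compatibility of \<open>path_less\<close> with contexts, all words of the substituted
  rest lie below \<open>w\<close>. Irreflexivity then keeps \<open>w\<close> out of that rest, so
  its coefficient 1 survives.\<close>

lemma lead_ksubst_rb_relation:
  fixes lam :: "'k::comm_ring_1" and x y :: "'x::linorder bword"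
  assumes q: "q \<in> star_words"
  defines "w \<equiv> star_subst q (bracket (bracket x \<cdot> y))"
  shows "is_lead pl_le (ksubst q (rb_relation lam (kmono x) (kmono y))) w"
    and "Poly_Mapping.lookup (ksubst q (rb_relation lam (kmono x) (kmono y))) w = 1"
proof -
  let ?r = "ksubst q (rb_rest lam (kmono x) (kmono y))"
  have less: "path_less m w" if "m \<in> Poly_Mapping.keys ?r" for m
    unfolding w_def by (rule path_less_ksubst_rb_rest[OF q that])
  have eq: "ksubst q (rb_relation lam (kmono x) (kmono y)) = kmono w - ?r"
    by (simp add: rb_relation_rest ksubst_linear w_def)
  have "Poly_Mapping.lookup ?r w = 0"
    using less[of w] path_less_irrefl[of w] by (auto simp: in_keys_iff)
  then show coeff: "Poly_Mapping.lookup (ksubst q (rb_relation lam (kmono x) (kmono y))) w = 1"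
    by (simp add: eq lookup_minus lookup_kmono)
  have "Poly_Mapping.keys (kmono w - ?r) \<subseteq> {w} \<union> Poly_Mapping.keys ?r"
    using keys_minus_subset[of "kmono w" ?r] by simp
  then show "is_lead pl_le (ksubst q (rb_relation lam (kmono x) (kmono y))) w"
    using coeff less unfolding is_lead_def
    by (auto simp: eq in_keys_iff intro!: strict_part_path_less)
qed

lemma ksubst_star [simp]: "ksubst (bletter None) f = f"
  by (induction f rule: kmono_keys_induct) (simp_all add: ksubst_linear)

lemma is_lead_unique: "is_lead leq f u \<Longrightarrow> is_lead leq f v \<Longrightarrow> u = v"
  by (auto simp: is_lead_def strict_part_def)

lemma lead_rb_relation:
  fixes x y :: "'x::linorder bword"
  shows "is_lead pl_le (rb_relation lam (kmono x) (kmono y)) w \<longleftrightarrow> w = bracket (bracket x \<cdot> y)"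
  using lead_ksubst_rb_relation(1)[OF star_words_star, where x = x and y = y and lam = lam] is_lead_unique
  by fastforce

section \<open>Linear closure of the elements trivial modulo a set and a word\<close>

lemma trivial_mod_add_sum:
  assumes "trivial_mod leq S w h"
    "\<forall>i<n. q i \<in> star_words \<and> s i \<in> S \<and> (\<exists>v. is_lead leq (ksubst (q i) (s i)) v \<and> strict_part leq v w)"
  shows "trivial_mod leq S w (h + (\<Sum>i<(n::nat). kscale (c i) (ksubst (q i) (s i))))"
  using assms(2)
proof (induction n)
  case 0
  then show ?case using assms(1) by simp
next
  case (Suc n)
  then have "trivial_mod leq S w (h + (\<Sum>i<n. kscale (c i) (ksubst (q i) (s i))))" by simp
  then obtain n' c' q' s' where *: "\<forall>i<n'. q' i \<in> star_words \<and> s' i \<in> S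
      \<and> (\<exists>v. is_lead leq (ksubst (q' i) (s' i)) v \<and> strict_part leq v w)"
    "h + (\<Sum>i<n. kscale (c i) (ksubst (q i) (s i))) = (\<Sum>i<(n'::nat). kscale (c' i) (ksubst (q' i) (s' i)))"
    unfolding trivial_mod_def by blast
  have "h + (\<Sum>i<Suc n. kscale (c i) (ksubst (q i) (s i)))
     = (\<Sum>i<n'. kscale (c' i) (ksubst (q' i) (s' i))) + kscale (c n) (ksubst (q n) (s n))"
    by (simp flip: *(2) add: add.assoc)
  \<comment> \<open>Function update at the first free index \<open>n'\<close> appends the new term
    without disturbing the earlier ones.\<close>
  also have "\<dots> = (\<Sum>i<Suc n'. kscale ((c'(n' := c n)) i) (ksubst ((q'(n' := q n)) i) ((s'(n' := s n)) i)))"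
    by (simp add: sum.lessThan_Suc)
  finally show ?case
    unfolding trivial_mod_def using *(1) Suc.prems
    by (intro exI[of _ "Suc n'"] exI[of _ "c'(n' := c n)"] exI[of _ "q'(n' := q n)"]
        exI[of _ "s'(n' := s n)"]) (auto simp: less_Suc_eq)
qed

lemma trivial_mod_zero: "trivial_mod leq S w 0"
  unfolding trivial_mod_def by (intro exI[of _ "0::nat"]) simp

lemma trivial_mod_add:
  assumes "trivial_mod leq S w h" "trivial_mod leq S w h'"
  shows "trivial_mod leq S w (h + h')"
  using trivial_mod_add_sum[OF assms(1)] assms(2) unfolding trivial_mod_def[of leq S w h'] by blast

lemma trivial_mod_kscale:
  assumes "trivial_mod leq S w h"
  shows "trivial_mod leq S w (kscale c h)"
proof -
  obtain n c' q s where *: "\<forall>i<n. q i \<in> star_words \<and> s i \<in> S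
      \<and> (\<exists>v. is_lead leq (ksubst (q i) (s i)) v \<and> strict_part leq v w)"
    "h = (\<Sum>i<(n::nat). kscale (c' i) (ksubst (q i) (s i)))"
    using assms unfolding trivial_mod_def by blast
  have "trivial_mod leq S w (0 + (\<Sum>i<n. kscale (c * c' i) (ksubst (q i) (s i))))"
    by (rule trivial_mod_add_sum[OF trivial_mod_zero *(1)])
  then show ?thesis by (simp add: *(2) kscale_sum)
qed

lemma trivial_mod_diff:
  assumes "trivial_mod leq S w h" "trivial_mod leq S w h'"
  shows "trivial_mod leq S w (h - h')"
  using trivial_mod_add[OF assms(1) trivial_mod_kscale[OF assms(2), of "- 1"]]
  by (simp add: kscale_minus_one)

lemma trivial_mod_ksubst:
  fixes lam :: "'k::comm_ring_1" and x y :: "'x::linorder bword"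
  assumes "q \<in> star_words" "path_less (star_subst q (bracket (bracket x \<cdot> y))) w"
  shows "trivial_mod pl_le (S_rbl lam) w (ksubst q (rb_relation lam (kmono x) (kmono y)))"
proof -
  have "\<exists>v. is_lead pl_le (ksubst q (rb_relation lam (kmono x) (kmono y))) v \<and> strict_part pl_le v w"
    using lead_ksubst_rb_relation(1)[OF assms(1)] strict_part_path_less[OF assms(2)] by blast
  then have "trivial_mod pl_le (S_rbl lam) w
      (0 + (\<Sum>i<1::nat. kscale 1 (ksubst q (rb_relation lam (kmono x) (kmono y)))))"
    using assms(1) by (intro trivial_mod_add_sum[OF trivial_mod_zero]) (auto simp: S_rbl_eq)
  then show ?thesis by simp
qed

lemmas trivial_mod_rb_relation = trivial_mod_ksubst[OF star_words_star, simplified]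

text \<open>This and the next two lemmas absorb surrounding brackets and word factors into the
  context, the form that \<open>trivial_mod_ksubst\<close> expects.\<close>

lemma kbracket_ksubst: "kbracket (ksubst q f) = ksubst (bracket q) f"
  by (induction f rule: kmono_keys_induct) (simp_all add: ksubst_linear kbracket_linear)

lemma kmul_ksubst_left: "kmul (kmono u) (ksubst q f) = ksubst (map_bword Some u \<cdot> q) f"
  by (induction f rule: kmono_keys_induct) (simp_all add: ksubst_linear kmul_linear)

lemma kmul_ksubst_right: "kmul (ksubst q f) (kmono u) = ksubst (q \<cdot> map_bword Some u) f"
  by (induction f rule: kmono_keys_induct) (simp_all add: ksubst_linear kmul_linear)

lemmas push_ksubst = kbracket_ksubst kmul_ksubst_left kmul_ksubst_right

lemma ksubst_cong: "(\<And>u. star_subst q u = star_subst r u) \<Longrightarrow> ksubst q f = ksubst r f"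
  by (simp add: ksubst_def)

lemma trivial_mod_linear:
  assumes "\<And>m. m \<in> Poly_Mapping.keys f \<Longrightarrow> trivial_mod leq S w (\<Phi> (kmono m))"
    "\<Phi> 0 = 0" "\<And>f g. \<Phi> (f + g) = \<Phi> f + \<Phi> g" "\<And>c f. \<Phi> (kscale c f) = kscale c (\<Phi> f)"
  shows "trivial_mod leq S w (\<Phi> f)"
  by (induction f rule: kmono_keys_induct)
    (simp_all add: assms trivial_mod_zero trivial_mod_add trivial_mod_kscale)

lemma rb_relation_zero [simp]: "rb_relation lam 0 g = 0" "rb_relation lam f 0 = 0"
  by (simp_all add: rb_relation_def)

lemma rb_relation_linear:
  "rb_relation lam (f + f') g = rb_relation lam f g + rb_relation lam f' g"
  "rb_relation lam f (g + g') = rb_relation lam f g + rb_relation lam f g'"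
  "rb_relation lam (kscale c f) g = kscale c (rb_relation lam f g)"
  "rb_relation lam f (kscale c g) = kscale c (rb_relation lam f g)"
  by (simp_all add: rb_relation_def kbracket_linear kmul_linear kscale_linear mult.commute algebra_simps)

section \<open>The inclusion compositions with distinct positions\<close>

context
  fixes lam :: "'k::comm_ring_1"
begin

abbreviation "trivial_below w \<equiv> trivial_mod pl_le (S_rbl lam) (w :: 'x::linorder bword)"
abbreviation "rb_rel x y \<equiv> rb_relation lam (kmono x) (kmono y :: 'x::linorder bword \<Rightarrow>\<^sub>0 'k)"

lemma trivial_overlap:
  "trivial_below (bracket (bracket (bracket u \<cdot> v) \<cdot> y)) (rb_rel (bracket u \<cdot> v) y - kbracket (kmul (rb_rel u v) (kmono y)))"
  (is "trivial_below ?w _")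
proof -
  have le: "head_factor_path_length u \<le> head_path_length u"
    by (rule head_factor_path_length_le)
  have 1: "trivial_below ?w (kmul (rb_rel u v) (kmono (bracket y)))"
    using trivial_mod_ksubst[of "bletter None \<cdot> map_bword Some (bracket y)" u v ?w lam]
      kmul_ksubst_right[of "bletter None" "rb_rel u v" "bracket y"]
    by (simp add: star_words_def letters_map_bword count_list_0_iff path_less_head)
  have 2: "trivial_below ?w (kmul (kmono (bracket u)) (rb_rel v y))"
    using trivial_mod_ksubst[of "map_bword Some (bracket u) \<cdot> bletter None" v y ?w lam]
      kmul_ksubst_left[of "bracket u" "bletter None" "rb_rel v y"]
    by (simp add: star_words_def letters_map_bword count_list_0_iff path_less_head)
  have 3: "trivial_below ?w (kbracket (kmul (kmono u) (rb_rel v y)))"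
    using trivial_mod_ksubst[of "bracket (map_bword Some u \<cdot> bletter None)" v y ?w lam]
      kmul_ksubst_left[of "u" "bletter None" "rb_rel v y"] le
    by (simp add: star_words_def letters_map_bword count_list_0_iff path_less_head kbracket_ksubst)
  have 4: "trivial_below ?w (rb_rel u (v \<cdot> bracket y))" "trivial_below ?w (rb_rel u (v \<cdot> y))" "trivial_below ?w (rb_rel u (bracket v \<cdot> y))"
    "trivial_below ?w (rb_rel (u \<cdot> bracket v) y)" "trivial_below ?w (rb_rel (u \<cdot> v) y)"
    using le by (auto intro!: trivial_mod_rb_relation path_less_head)
  \<comment> \<open>The two copies of \<lfloor>\<lfloor>\<lfloor>u\<rfloor>v\<rfloor>y\<rfloor>
    cancel. Each of the six other words of the composition is the leading word of one term on the
    right. Reducing \<lfloor>\<lfloor>u\<rfloor>\<lfloor>v\<rfloor>y\<rfloor> creates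
    \<lfloor>u\<rfloor>\<lfloor>\<lfloor>v\<rfloor>y\<rfloor> and
    \<lfloor>u\<lfloor>\<lfloor>v\<rfloor>y\<rfloor>\<rfloor>, which the two terms with
    \<open>rb_rel v y\<close> remove.\<close>
  have "rb_rel (bracket u \<cdot> v) y - kbracket (kmul (rb_rel u v) (kmono y))
      = rb_rel u (v \<cdot> bracket y) + kscale lam (rb_rel u (v \<cdot> y)) + rb_rel u (bracket v \<cdot> y)
        - rb_rel (u \<cdot> bracket v) y - kscale lam (rb_rel (u \<cdot> v) y)
        + kmul (kmono (bracket u)) (rb_rel v y) - kbracket (kmul (kmono u) (rb_rel v y))
        - kmul (rb_rel u v) (kmono (bracket y))"
    by (simp add: rb_relation_def kbracket_linear kmul_linear kscale_linear bmul_assoc algebra_simps)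
  also have "trivial_below ?w \<dots>"
    by (intro trivial_mod_diff[OF trivial_mod_diff[OF trivial_mod_add[OF trivial_mod_diff[OF
            trivial_mod_diff[OF trivial_mod_add[OF trivial_mod_add]]]]]] trivial_mod_kscale 1 2 3 4)
  finally show ?thesis .
qed

text \<open>Write R for the relation, g for \<open>rb_rel u v\<close> and r for the rest inside
  \<open>q\<close>, so that \<open>x\<close> is the sum of q|g and r. By bilinearity the composition
  is R(r,y) minus the rest of R(q|g,y). In R(r,y) every word of r is below \<open>x\<close>; the
  three terms of the rest are g inside contexts, with leading words
  \<lfloor>x\<rfloor>\<lfloor>y\<rfloor>, \<lfloor>x\<lfloor>y\<rfloor>\<rfloor> and
  \<lfloor>xy\<rfloor>.\<close>

lemma trivial_nested_left:
  assumes q: "q \<in> star_words" and x: "x = star_subst q (bracket (bracket u \<cdot> v))"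
  shows "trivial_below (bracket (bracket x \<cdot> y))
    (rb_rel x y - kbracket (kmul (kbracket (ksubst q (rb_rel u v))) (kmono y)))" (is "trivial_below ?w _")
proof -
  let ?g = "rb_rel u v"
  let ?r = "ksubst q (rb_rest lam (kmono u) (kmono v))"
  have g: "ksubst q ?g = kmono x - ?r"
    by (simp add: x rb_relation_rest ksubst_linear)
  \<comment> \<open>The same equation with the product evaluated, as the simplifier presents
    it.\<close>
  have x': "star_subst q (bracket (Conc (Brk u) v)) = x"
    by (simp add: x)
  have le: "head_factor_path_length x \<le> head_path_length x"
    by (rule head_factor_path_length_le)
  have 1: "trivial_below ?w (rb_relation lam ?r (kmono y))"
  proof (rule trivial_mod_linear[where f = ?r])
    fix m assume "m \<in> Poly_Mapping.keys ?r"
    then have "path_less m x"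
      unfolding x by (rule path_less_ksubst_rb_rest[OF q])
    from path_less_bracket[OF path_less_bmul_right[OF path_less_bracket[OF this]]]
    show "trivial_below ?w (rb_rel m y)"
      by (simp add: trivial_mod_rb_relation)
  qed (simp_all add: rb_relation_linear)
  have 2: "trivial_below ?w (ksubst (bracket q \<cdot> bracket (map_bword Some y)) ?g)"
    "trivial_below ?w (ksubst (bracket (q \<cdot> bracket (map_bword Some y))) ?g)"
    "trivial_below ?w (ksubst (bracket (q \<cdot> map_bword Some y)) ?g)"
    using q le
    by (auto intro!: trivial_mod_ksubst path_less_head simp: star_words_def x')
  have "rb_rel x y - kbracket (kmul (kbracket (ksubst q ?g)) (kmono y))
     = rb_relation lam ?r (kmono y) - rb_rest lam (ksubst q ?g) (kmono y)"
    unfolding g by (simp add: rb_relation_def rb_rest_def kbracket_linear kmul_linear kscale_linear algebra_simps)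
  also have "rb_rest lam (ksubst q ?g) (kmono y) = ksubst (bracket q \<cdot> bracket (map_bword Some y)) ?g
     - ksubst (bracket (q \<cdot> bracket (map_bword Some y))) ?g
     - kscale lam (ksubst (bracket (q \<cdot> map_bword Some y)) ?g)"
    by (simp add: rb_rest_def push_ksubst)
  finally show ?thesis
    using trivial_mod_diff[OF 1 trivial_mod_diff[OF trivial_mod_diff[OF 2(1,2)] trivial_mod_kscale[OF 2(3)]]]
    by simp
qed

text \<open>The splitting of \<open>trivial_nested_left\<close>, applied to the second argument. For
  the words of the rest the first letter no longer decides; compatibility of
  \<open>path_less\<close> with left factors does.\<close>

lemma trivial_nested_right:
  assumes q: "q \<in> star_words" and y: "y = star_subst q (bracket (bracket u \<cdot> v))"
  shows "trivial_below (bracket (bracket x \<cdot> y))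
    (rb_rel x y - kbracket (kmul (kmono (bracket x)) (ksubst q (rb_rel u v))))" (is "trivial_below ?w _")
proof -
  let ?g = "rb_rel u v"
  let ?r = "ksubst q (rb_rest lam (kmono u) (kmono v))"
  have g: "ksubst q ?g = kmono y - ?r"
    by (simp add: y rb_relation_rest ksubst_linear)
  have y': "star_subst q (bracket (Conc (Brk u) v)) = y"
    by (simp add: y)
  have le: "head_factor_path_length x \<le> head_path_length x"
    by (rule head_factor_path_length_le)
  have 1: "trivial_below ?w (rb_relation lam (kmono x) ?r)"
  proof (rule trivial_mod_linear[where f = ?r])
    fix m assume "m \<in> Poly_Mapping.keys ?r"
    then have "path_less m y"
      unfolding y by (rule path_less_ksubst_rb_rest[OF q])
    from path_less_bracket[OF path_less_bmul_left[OF this, of "bracket x"]]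
    show "trivial_below ?w (rb_rel x m)"
      by (simp add: trivial_mod_rb_relation)
  qed (simp_all add: rb_relation_linear)
  have 2: "trivial_below ?w (ksubst (bracket (map_bword Some x) \<cdot> bracket q) ?g)"
    "trivial_below ?w (ksubst (bracket (map_bword Some x \<cdot> bracket q)) ?g)"
    "trivial_below ?w (ksubst (bracket (map_bword Some x \<cdot> q)) ?g)"
    using q le
    by (auto intro!: trivial_mod_ksubst path_less_head simp: star_words_def y')
  have "rb_rel x y - kbracket (kmul (kmono (bracket x)) (ksubst q ?g))
     = rb_relation lam (kmono x) ?r - rb_rest lam (kmono x) (ksubst q ?g)"
    unfolding g by (simp add: rb_relation_def rb_rest_def kbracket_linear kmul_linear kscale_linear algebra_simps)
  also have "rb_rest lam (kmono x) (ksubst q ?g) = ksubst (bracket (map_bword Some x) \<cdot> bracket q) ?g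
     - ksubst (bracket (map_bword Some x \<cdot> bracket q)) ?g
     - kscale lam (ksubst (bracket (map_bword Some x \<cdot> q)) ?g)"
    by (simp add: rb_rest_def push_ksubst)
  finally show ?thesis
    using trivial_mod_diff[OF 1 trivial_mod_diff[OF trivial_mod_diff[OF 2(1,2)] trivial_mod_kscale[OF 2(3)]]]
    by simp
qed

end

section \<open>Positions at which a leading word can occur inside another\<close>

lemma star_subst_prime_breadth_one:
  "\<exists>r'. star_subst_prime p (Sing r) = Sing r'"
  by (cases p) (auto split: option.splits)

text \<open>The star is the whole context, stands for \<lfloor>x\<rfloor>, or lies inside
  \<open>x\<close> or inside \<open>y\<close>. The last three cases describe \<open>q\<close> by its
  effect on every \<open>t\<close>, which is what \<open>ksubst_cong\<close> consumes.\<close>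

lemma star_subst_eq_bracket_cases:
  assumes q: "q \<in> star_words" and eq: "bracket (bracket x \<cdot> y) = star_subst q (bracket g)"
  obtains (whole) "q = bletter None" "bracket x \<cdot> y = g"
    | (overlap) "g = x" "\<And>t. star_subst q t = bracket (t \<cdot> y)"
    | (left) q' where "q' \<in> star_words" "x = star_subst q' (bracket g)"
        "\<And>t. star_subst q t = bracket (bracket (star_subst q' t) \<cdot> y)"
    | (right) q' where "q' \<in> star_words" "y = star_subst q' (bracket g)"
        "\<And>t. star_subst q t = bracket (bracket x \<cdot> star_subst q' t)"
proof -
  have c: "count_list (letters q) None = 1" using q by (simp add: star_words_def)
  show thesis
  proof (cases q)
    \<comment> \<open>A context with at least two prime factors cannot produce a single
      bracket.\<close>
    case (Conc p r)
    with eq star_subst_prime_breadth_one[of p "Brk g"] show thesis by auto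
  next
    case (Sing p)
    show thesis
    proof (cases p)
      case (Letter a)
      then show thesis
        using Sing eq c whole by (cases a) auto
    next
      case (Brk q1)
      have eq1: "bracket x \<cdot> y = star_subst q1 (bracket g)"
        using eq Sing Brk by simp
      have c1: "count_list (letters q1) None = 1" using c Sing Brk by simp
      show thesis
      proof (cases q1)
        case (Sing p')
        with eq1 star_subst_prime_breadth_one[of p' "Brk g"] show thesis by auto
      next
        case (Conc p' r)
        obtain r' where r': "star_subst_prime p' (bracket g) = Sing r'"
          using star_subst_prime_breadth_one by blast
        with eq1 Conc have p': "star_subst_prime p' (bracket g) = bracket x"
          and y: "y = star_subst r (bracket g)" by auto
        have sq: "star_subst q t = bracket (star_subst_prime p' t \<cdot> star_subst r t)" for t
          by (simp add: Sing Brk Conc \<open>q = Sing p\<close>)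
        consider "count_list (letters_prime p') None = 1" "count_list (letters r) None = 0"
          | "count_list (letters_prime p') None = 0" "count_list (letters r) None = 1"
          using c1 Conc by fastforce
        then show thesis
        proof cases
          case 1
          have r: "star_subst r t = y" for t
            using star_subst_no_star(1)[of r t "bracket g"] 1 y by (simp add: count_list_0_iff)
          show thesis
          proof (cases p')
            case (Letter a)
            with 1 have "a = None" by (auto split: if_splits)
            then show thesis
              using overlap p' Letter r sq by simp
          next
            case (Brk q3)
            then show thesis
              using left[of q3] 1 p' r sq by (simp add: star_words_def)
          qed
        next
          case 2
          have "star_subst_prime p' t = bracket x" for t
            using star_subst_no_star(2)[of p' t "bracket g"] 2 p' by (simp add: count_list_0_iff)
          then show thesis
            using right[of r] 2 y sq by (simp add: star_words_def)
        qed
      qed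
    qed
  qed
qed

theorem groebner_shirshov_S_rbl:
  "groebner_shirshov_basis pl_le (S_rbl lam :: ('x::linorder bword \<Rightarrow>\<^sub>0 'k::comm_ring_1) set)"
proof -
  have monic: "kmonic pl_le (rb_relation lam (kmono x) (kmono y))" for x y :: "'x bword"
    using lead_ksubst_rb_relation[OF star_words_star, where x = x and y = y and lam = lam] by (auto simp: kmonic_def)
  have inter: False if "intersection_composition pl_le (rb_relation lam (kmono x) (kmono y))
      (rb_relation lam (kmono u) (kmono v)) w h" for x y u v w :: "'x bword" and h :: "'x bword \<Rightarrow>\<^sub>0 'k"
    using that by (auto simp: intersection_composition_def lead_rb_relation)
  have incl: "trivial_mod pl_le (S_rbl lam) w h"
    if composition: "including_composition pl_le (rb_relation lam (kmono x) (kmono y))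
      (rb_relation lam (kmono u) (kmono v)) w h" for x y u v w :: "'x bword" and h :: "'x bword \<Rightarrow>\<^sub>0 'k"
  proof -
    let ?f = "rb_relation lam (kmono x) (kmono y)" and ?g = "rb_relation lam (kmono u) (kmono v)"
    obtain q g0 where q: "q \<in> star_words" and leads: "is_lead pl_le ?f w" "is_lead pl_le ?g g0"
      and wq: "w = star_subst q g0" and h: "h = ?f - ksubst q ?g"
      using composition unfolding including_composition_def by blast
    have w: "w = bracket (bracket x \<cdot> y)"
      and eq: "bracket (bracket x \<cdot> y) = star_subst q (bracket (bracket u \<cdot> v))"
      using leads wq unfolding lead_rb_relation by simp_all
    from q eq show ?thesis
    proof (cases rule: star_subst_eq_bracket_cases)
      case whole
      \<comment> \<open>Equality of the leading words forces \<open>x = u\<close> and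
        \<open>y = v\<close>, so the composition is zero.\<close>
      then show ?thesis by (simp add: h trivial_mod_zero)
    next
      case overlap
      have "ksubst q ?g = ksubst (bracket (bletter None \<cdot> map_bword Some y)) ?g"
        by (rule ksubst_cong) (simp add: overlap)
      also have "\<dots> = kbracket (kmul ?g (kmono y))"
        using kmul_ksubst_right[of "bletter None" ?g y] by (simp add: kbracket_ksubst)
      finally show ?thesis
        using trivial_overlap[where lam = lam and u = u and v = v and y = y] overlap(1) by (simp add: h w)
    next
      case (left q')
      have "ksubst q ?g = ksubst (bracket (bracket q' \<cdot> map_bword Some y)) ?g"
        by (rule ksubst_cong) (simp add: left)
      also have "\<dots> = kbracket (kmul (kbracket (ksubst q' ?g)) (kmono y))"
        by (simp add: push_ksubst)
      finally show ?thesis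
        using trivial_nested_left[OF left(1,2)] by (simp add: h w)
    next
      case (right q')
      have "ksubst q ?g = ksubst (bracket (map_bword Some (bracket x) \<cdot> q')) ?g"
        by (rule ksubst_cong) (simp add: right)
      also have "\<dots> = kbracket (kmul (kmono (bracket x)) (ksubst q' ?g))"
        by (simp add: push_ksubst)
      finally show ?thesis
        using trivial_nested_right[OF right(1,2)] by (simp add: h w)
    qed
  qed
  show ?thesis
    using monic inter incl unfolding groebner_shirshov_basis_def S_rbl_eq by blast
qed

section \<open>The quotient\<close>

lemma ring_of_type_algebra_simps [simp]:
  "carrier (ring_of_type_algebra :: 'k::comm_ring_1 ring) = UNIV"
  "x \<otimes>\<^bsub>ring_of_type_algebra\<^esub> y = x * y" "x \<oplus>\<^bsub>ring_of_type_algebra\<^esub> y = x + y"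
  "\<one>\<^bsub>ring_of_type_algebra\<^esub> = (1 :: 'k)" "\<zero>\<^bsub>ring_of_type_algebra\<^esub> = (0 :: 'k)"
  by (simp_all add: ring_of_type_algebra_def)

lemma bword_algebra_simps [simp]:
  "carrier bword_algebra = UNIV" "f \<otimes>\<^bsub>bword_algebra\<^esub> g = kmul f g"
  "f \<oplus>\<^bsub>bword_algebra\<^esub> g = f + g" "\<zero>\<^bsub>bword_algebra\<^esub> = 0"
  "c \<odot>\<^bsub>bword_algebra\<^esub> f = kscale c f" "oper bword_algebra f = kbracket f"
  by (simp_all add: bword_algebra_def)

text \<open>Passes from the record formulation to the concrete operations. Closure under negation,
  part of being a subgroup, comes from scaling by -1.\<close>

lemma operated_ideal_iff_kideal:
  fixes I :: "('x bword \<Rightarrow>\<^sub>0 'k::comm_ring_1) set"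
  shows "operated_ideal ring_of_type_algebra bword_algebra I \<longleftrightarrow> kideal I"
proof -
  have inv: "inv\<^bsub>add_monoid bword_algebra\<^esub> f = - f" for f :: "'x bword \<Rightarrow>\<^sub>0 'k"
    unfolding m_inv_def by (rule the_equality) (auto dest: minus_unique)
  have "submodule I ring_of_type_algebra bword_algebra \<longleftrightarrow>
      0 \<in> I \<and> (\<forall>f\<in>I. \<forall>g\<in>I. f + g \<in> I) \<and> (\<forall>c. \<forall>f\<in>I. kscale c f \<in> I)"
  proof -
    have "- f \<in> I" if "\<forall>c. \<forall>f\<in>I. kscale c f \<in> I" "f \<in> I" for f
      using that by (metis kscale_minus_one)
    then show ?thesis
      by (auto simp: submodule_def submodule_axioms_def subgroup_def inv[simplified])
  qed
  then show ?thesis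
    by (auto simp: operated_ideal_def kideal_def)
qed

lemma Id_rbl_eq: "Id_rbl lam = \<Inter> {I. kideal I \<and> S_rbl lam \<subseteq> I}"
  by (simp add: operated_Id_def operated_ideal_iff_kideal)

lemma kideal_Id_rbl: "kideal (Id_rbl lam)"
  unfolding Id_rbl_eq kideal_def by blast

lemma S_rbl_subset_Id_rbl: "S_rbl lam \<subseteq> Id_rbl lam"
  unfolding Id_rbl_eq by blast

lemma Id_rbl_least: "kideal I \<Longrightarrow> S_rbl lam \<subseteq> I \<Longrightarrow> Id_rbl lam \<subseteq> I"
  unfolding Id_rbl_eq by blast

lemma rb_relation_in_kideal:
  assumes I: "kideal I" "S_rbl lam \<subseteq> I"
  shows "rb_relation lam f g \<in> I"
proof (induction f rule: kmono_keys_induct)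
  case (mono u)
  show ?case
  proof (induction g rule: kmono_keys_induct)
    case (mono v)
    then show ?case using I(2) by (auto simp: S_rbl_eq)
  qed (simp_all add: rb_relation_linear kidealD[OF I(1)])
qed (simp_all add: rb_relation_linear kidealD[OF I(1)])

text \<open>N f - f lies in the ideal, which gives one direction; for the other, the kernel of N is
  an operated ideal that contains all relations.\<close>

lemma knormal_eq_zero_iff: "knormal lam f = 0 \<longleftrightarrow> f \<in> Id_rbl lam"
proof
  assume "knormal lam f = 0"
  with knormal_cong[OF kideal_Id_rbl S_rbl_subset_Id_rbl, of lam f] show "f \<in> Id_rbl lam"
    using kidealD(7)[OF kideal_Id_rbl, of "- f" lam] by simp
next
  have "S_rbl lam \<subseteq> {f. knormal lam f = 0}"
    by (auto simp: S_rbl_eq knormal_rb_relation)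
  then show "f \<in> Id_rbl lam \<Longrightarrow> knormal lam f = 0"
    using Id_rbl_least[OF knormal_kernel_kideal] by blast
qed

section \<open>Cosets, and the Rota-Baxter structure of the quotient\<close>

abbreviation kcoset :: "('x bword \<Rightarrow>\<^sub>0 'k::comm_ring_1) set \<Rightarrow> ('x bword \<Rightarrow>\<^sub>0 'k) \<Rightarrow> ('x bword \<Rightarrow>\<^sub>0 'k) set" where
  "kcoset I f \<equiv> I +>\<^bsub>bword_algebra\<^esub> f"

context
  fixes I :: "('x bword \<Rightarrow>\<^sub>0 'k::comm_ring_1) set"
  assumes I: "kideal I"
begin

lemma mem_kcoset: "g \<in> kcoset I f \<longleftrightarrow> g - f \<in> I"
  by (auto simp: a_r_coset_def' intro: bexI[of _ "g - f"])

lemma kcoset_self: "f \<in> kcoset I f"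
  by (simp add: mem_kcoset kidealD(1)[OF I])

lemma kcoset_eqI:
  assumes "f - g \<in> I"
  shows "kcoset I f = kcoset I g"
proof (rule equalityI; rule subsetI)
  fix h assume "h \<in> kcoset I f"
  then show "h \<in> kcoset I g"
    using kidealD(2)[OF I, of "h - f" "f - g"] assms by (simp add: mem_kcoset)
next
  fix h assume "h \<in> kcoset I g"
  then show "h \<in> kcoset I f"
    using kidealD(8)[OF I, of "h - g" "f - g"] assms by (simp add: mem_kcoset)
qed

lemma kcoset_eq_iff: "kcoset I f = kcoset I g \<longleftrightarrow> f - g \<in> I"
  using kcoset_eqI kcoset_self[of f] by (auto simp: mem_kcoset)

lemma carrier_quotient: "carrier (quotient_algebra bword_algebra I) = range (kcoset I)"
  by (auto simp: quotient_algebra_def A_RCOSETS_def')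

lemma zero_quotient: "\<zero>\<^bsub>quotient_algebra bword_algebra I\<^esub> = kcoset I 0"
  by (auto simp: quotient_algebra_def mem_kcoset)

lemma add_quotient: "kcoset I f \<oplus>\<^bsub>quotient_algebra bword_algebra I\<^esub> kcoset I g = kcoset I (f + g)"
proof -
  have "h \<in> kcoset I f <+>\<^bsub>bword_algebra\<^esub> kcoset I g \<longleftrightarrow> h - (f + g) \<in> I" for h
  proof
    assume "h \<in> kcoset I f <+>\<^bsub>bword_algebra\<^esub> kcoset I g"
    then obtain a b where "h = a + b" "a - f \<in> I" "b - g \<in> I"
      by (auto simp: set_add_def' mem_kcoset)
    then show "h - (f + g) \<in> I"
      using kidealD(2)[OF I, of "a - f" "b - g"] by (simp add: algebra_simps)
  next
    assume "h - (f + g) \<in> I"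
    then have "h - g \<in> kcoset I f" by (simp add: mem_kcoset algebra_simps)
    then show "h \<in> kcoset I f <+>\<^bsub>bword_algebra\<^esub> kcoset I g"
      using kcoset_self[of g] unfolding set_add_def' by (intro UN_I[of "h - g"] UN_I[of g]) simp_all
  qed
  then have "kcoset I f <+>\<^bsub>bword_algebra\<^esub> kcoset I g = kcoset I (f + g)"
    using mem_kcoset by blast
  then show ?thesis
    by (simp add: quotient_algebra_def)
qed

lemma smult_quotient: "c \<odot>\<^bsub>quotient_algebra bword_algebra I\<^esub> kcoset I f = kcoset I (kscale c f)"
proof -
  have "(\<Union>a\<in>kcoset I f. kcoset I (kscale c a)) = kcoset I (kscale c f)"
    using kidealD(3)[OF I, of "_ - f" c]
    by (intro UN_constant_eq[OF kcoset_self] ballI kcoset_eqI) (simp add: mem_kcoset kscale_linear)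
  then show ?thesis by (simp add: quotient_algebra_def)
qed

lemma oper_quotient: "oper (quotient_algebra bword_algebra I) (kcoset I f) = kcoset I (kbracket f)"
proof -
  have "(\<Union>a\<in>kcoset I f. kcoset I (kbracket a)) = kcoset I (kbracket f)"
    using kidealD(6)[OF I, of "_ - f"]
    by (intro UN_constant_eq[OF kcoset_self] ballI kcoset_eqI) (simp add: mem_kcoset kbracket_linear)
  then show ?thesis by (simp add: quotient_algebra_def)
qed

lemma mult_quotient: "kcoset I f \<otimes>\<^bsub>quotient_algebra bword_algebra I\<^esub> kcoset I g = kcoset I (kmul f g)"
proof -
  \<comment> \<open>The product of cosets is a union over pairs of representatives; they are fixed
    one at a time, using two-sidedness of the ideal.\<close>
  have "(\<Union>b\<in>kcoset I g. kcoset I (kmul a b)) = kcoset I (kmul a g)" for a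
    using kidealD(4)[OF I, of "_ - g" a]
    by (intro UN_constant_eq[OF kcoset_self] ballI kcoset_eqI) (simp add: mem_kcoset kmul_linear)
  moreover have "(\<Union>a\<in>kcoset I f. kcoset I (kmul a g)) = kcoset I (kmul f g)"
    using kidealD(5)[OF I, of "_ - f" g]
    by (intro UN_constant_eq[OF kcoset_self] ballI kcoset_eqI) (simp add: mem_kcoset kmul_linear)
  ultimately show ?thesis by (simp add: quotient_algebra_def rcoset_mult_def)
qed

lemmas quotient_simps = carrier_quotient zero_quotient add_quotient smult_quotient oper_quotient mult_quotient

lemma rota_baxter_quotient:
  assumes "S_rbl lam \<subseteq> I"
  shows "nonunitary_rota_baxter_algebra ring_of_type_algebra (quotient_algebra bword_algebra I) lam"
proof -
  let ?Q = "quotient_algebra bword_algebra I"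
  have minus: "\<exists>g. kcoset I (f + g) = kcoset I 0" for f
    by (rule exI[of _ "- f"]) simp
  have "abelian_group ?Q"
    by (rule abelian_groupI) (auto simp: quotient_simps ac_simps minus)
  then have "module ring_of_type_algebra ?Q"
    by (intro moduleI) (auto simp: quotient_simps kscale_linear kscale_add_left)
  then have "nonunitary_algebra ring_of_type_algebra ?Q"
    by (intro nonunitary_algebra.intro nonunitary_algebra_axioms.intro)
      (auto simp: quotient_simps kmul_linear kmul_assoc)
  moreover have "kcoset I (kmul (kbracket f) (kbracket g))
      = kcoset I (kbracket (kmul (kbracket f) g) + kbracket (kmul f (kbracket g)) + kscale lam (kbracket (kmul f g)))"
    for f g
    using rb_relation_in_kideal[OF I assms, of f g] unfolding rb_relation_def
    by (intro kcoset_eqI[symmetric])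
  ultimately show ?thesis
    by (intro nonunitary_rota_baxter_algebra.intro nonunitary_rota_baxter_algebra_axioms.intro)
      (auto simp: quotient_simps kbracket_linear)
qed

end

section \<open>Evaluation in a Rota-Baxter algebra and the universal property\<close>

primrec word_eval :: "('k, 'b) operated_algebra \<Rightarrow> ('x \<Rightarrow> 'b) \<Rightarrow> 'x bword \<Rightarrow> 'b"
  and prime_eval :: "('k, 'b) operated_algebra \<Rightarrow> ('x \<Rightarrow> 'b) \<Rightarrow> 'x bprime \<Rightarrow> 'b" where
  "word_eval B f (Sing p) = prime_eval B f p"
| "word_eval B f (Conc p w) = prime_eval B f p \<otimes>\<^bsub>B\<^esub> word_eval B f w"
| "prime_eval B f (Letter x) = f x"
| "prime_eval B f (Brk w) = oper B (word_eval B f w)"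

definition keval :: "('k::comm_ring_1, 'b) operated_algebra \<Rightarrow> ('x \<Rightarrow> 'b) \<Rightarrow> ('x bword \<Rightarrow>\<^sub>0 'k) \<Rightarrow> 'b" where
  "keval B f g = (\<Oplus>\<^bsub>B\<^esub>u\<in>Poly_Mapping.keys g. Poly_Mapping.lookup g u \<odot>\<^bsub>B\<^esub> word_eval B f u)"

context
  fixes lam :: "'k::comm_ring_1" and B :: "('k, 'b) operated_algebra" and f :: "'x \<Rightarrow> 'b"
  assumes B: "nonunitary_rota_baxter_algebra ring_of_type_algebra B lam"
    and f: "range f \<subseteq> carrier B"
begin

interpretation B: nonunitary_rota_baxter_algebra ring_of_type_algebra B lam
  by (rule B)

lemmas B_closed = B.mult_closed B.oper_closed B.smult_closed

lemma word_eval_closed: "word_eval B f w \<in> carrier B"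
  and prime_eval_closed: "prime_eval B f p \<in> carrier B"
  for w :: "'x bword" and p :: "'x bprime"
  using f by (induction w and p) (auto intro: B_closed)

lemma word_eval_bmul: "word_eval B f (u \<cdot> v) = word_eval B f u \<otimes>\<^bsub>B\<^esub> word_eval B f v"
  by (induction u) (auto simp: B.mult_assoc word_eval_closed prime_eval_closed)

lemma zero_smult: "x \<in> carrier B \<Longrightarrow> 0 \<odot>\<^bsub>B\<^esub> x = \<zero>\<^bsub>B\<^esub>"
  using B.smult_l_null[of x] by simp

lemma smult_word_eval_closed: "c \<odot>\<^bsub>B\<^esub> word_eval B f w \<in> carrier B"
  by (rule B.smult_closed) (simp_all add: word_eval_closed)

lemma keval_superset:
  assumes "finite F" "Poly_Mapping.keys g \<subseteq> F"
  shows "keval B f g = (\<Oplus>\<^bsub>B\<^esub>u\<in>F. Poly_Mapping.lookup g u \<odot>\<^bsub>B\<^esub> word_eval B f u)"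
  unfolding keval_def using assms
  by (intro B.add.finprod_mono_neutral_cong_left)
    (auto simp: in_keys_iff zero_smult word_eval_closed smult_word_eval_closed)

lemma keval_closed: "keval B f g \<in> carrier B"
  unfolding keval_def by (rule B.finsum_closed) (simp add: smult_word_eval_closed)

lemma keval_add: "keval B f (g + h) = keval B f g \<oplus>\<^bsub>B\<^esub> keval B f h"
proof -
  let ?F = "Poly_Mapping.keys g \<union> Poly_Mapping.keys h"
  have eq: "keval B f r = (\<Oplus>\<^bsub>B\<^esub>u\<in>?F. Poly_Mapping.lookup r u \<odot>\<^bsub>B\<^esub> word_eval B f u)"
    if "r \<in> {g, h, g + h}" for r
    using that keys_add[of g h] by (intro keval_superset) auto
  have "keval B f (g + h) = (\<Oplus>\<^bsub>B\<^esub>u\<in>?F. Poly_Mapping.lookup g u \<odot>\<^bsub>B\<^esub> word_eval B f u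
      \<oplus>\<^bsub>B\<^esub> Poly_Mapping.lookup h u \<odot>\<^bsub>B\<^esub> word_eval B f u)"
    using B.smult_l_distr word_eval_closed smult_word_eval_closed
    by (subst eq) (auto intro!: B.finsum_cong' simp: lookup_add)
  also have "\<dots> = keval B f g \<oplus>\<^bsub>B\<^esub> keval B f h"
    by (subst (1 2) eq) (auto intro!: B.finsum_addf simp: smult_word_eval_closed)
  finally show ?thesis .
qed

lemma keval_kscale: "keval B f (kscale c g) = c \<odot>\<^bsub>B\<^esub> keval B f g"
proof -
  have "keval B f (kscale c g)
      = (\<Oplus>\<^bsub>B\<^esub>u\<in>Poly_Mapping.keys g. c \<odot>\<^bsub>B\<^esub> (Poly_Mapping.lookup g u \<odot>\<^bsub>B\<^esub> word_eval B f u))"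
    using B.smult_assoc1 word_eval_closed smult_word_eval_closed
    by (subst keval_superset[OF finite_keys keys_kscale]) (auto intro!: B.finsum_cong')
  also have "\<dots> = c \<odot>\<^bsub>B\<^esub> keval B f g"
    unfolding keval_def by (rule B.finsum_smult_ldistr[symmetric]) (auto simp: smult_word_eval_closed)
  finally show ?thesis .
qed

lemma keval_kmono: "keval B f (kmono w) = word_eval B f w"
  using B.smult_one[OF word_eval_closed, of w]
  by (simp add: keval_def lookup_kmono B.finsum_insert word_eval_closed)

lemma keval_zero: "keval B f 0 = \<zero>\<^bsub>B\<^esub>"
  by (simp add: keval_def)

text \<open>The zero element is the multiple of itself by the scalar 0, and scalars can be pulled
  out of products and of the operator.\<close>

lemma B_zero: "x \<in> carrier B \<Longrightarrow> x \<otimes>\<^bsub>B\<^esub> \<zero>\<^bsub>B\<^esub> = \<zero>\<^bsub>B\<^esub>"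
  "x \<in> carrier B \<Longrightarrow> \<zero>\<^bsub>B\<^esub> \<otimes>\<^bsub>B\<^esub> x = \<zero>\<^bsub>B\<^esub>" "oper B \<zero>\<^bsub>B\<^esub> = \<zero>\<^bsub>B\<^esub>"
  using B.smult_mult_right[of 0 x "\<zero>\<^bsub>B\<^esub>"] B.smult_mult_left[of 0 "\<zero>\<^bsub>B\<^esub>" x] B.oper_smult[of 0 "\<zero>\<^bsub>B\<^esub>"]
  by (simp_all add: zero_smult B_closed)

lemmas keval_linear = keval_add keval_kscale keval_zero

lemma keval_kmul: "keval B f (kmul g h) = keval B f g \<otimes>\<^bsub>B\<^esub> keval B f h"
proof (induction g rule: kmono_keys_induct)
  case (mono u)
  show ?case
    by (induction h rule: kmono_keys_induct)
      (simp_all add: keval_kmono word_eval_bmul word_eval_closed keval_closed keval_linear kmul_linear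
        B.distr_right B.smult_mult_right B_zero)
qed (simp_all add: keval_closed keval_linear kmul_linear B.distr_left B.smult_mult_left B_zero)

lemma keval_kbracket: "keval B f (kbracket g) = oper B (keval B f g)"
  by (induction g rule: kmono_keys_induct)
    (simp_all add: keval_kmono keval_closed keval_linear kbracket_linear B.oper_add B.oper_smult B_zero)

lemma keval_diff_eq_zero_iff: "keval B f (g - h) = \<zero>\<^bsub>B\<^esub> \<longleftrightarrow> keval B f g = keval B f h"
proof
  assume "keval B f (g - h) = \<zero>\<^bsub>B\<^esub>"
  then show "keval B f g = keval B f h"
    using keval_add[of "g - h" h] by (simp add: keval_closed)
next
  assume *: "keval B f g = keval B f h"
  have "keval B f (g - h) = keval B f g \<oplus>\<^bsub>B\<^esub> (- 1) \<odot>\<^bsub>B\<^esub> keval B f h"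
    using keval_add[of g "kscale (- 1) h"] unfolding keval_kscale by (simp add: kscale_minus_one)
  also have "\<dots> = (1 + - 1) \<odot>\<^bsub>B\<^esub> keval B f g"
    using B.smult_l_distr[of 1 "- 1" "keval B f g"] B.smult_one[OF keval_closed, of g] *
    by (simp add: keval_closed)
  finally show "keval B f (g - h) = \<zero>\<^bsub>B\<^esub>"
    by (simp add: zero_smult keval_closed)
qed

text \<open>The kernel of evaluation is an operated ideal, and it contains the relations because
  \<open>B\<close> is a Rota-Baxter algebra. Evaluation is thus well defined on cosets.\<close>

lemma keval_Id_rbl: "g - h \<in> Id_rbl lam \<Longrightarrow> keval B f g = keval B f h"
proof -
  let ?J = "{g. keval B f g = \<zero>\<^bsub>B\<^esub>}"
  have "kideal ?J"
    by (simp add: kideal_def keval_linear keval_kmul keval_kbracket B_zero keval_closed B.smult_r_null)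
  moreover have "rb_relation lam g h \<in> ?J" for g h
    using B.rota_baxter[OF keval_closed keval_closed, of g h]
    unfolding rb_relation_def by (simp add: keval_diff_eq_zero_iff keval_linear keval_kmul keval_kbracket)
  then have "S_rbl lam \<subseteq> ?J"
    unfolding S_rbl_eq by blast
  ultimately show "g - h \<in> Id_rbl lam \<Longrightarrow> keval B f g = keval B f h"
    using Id_rbl_least[of ?J lam] keval_diff_eq_zero_iff[of g h] by blast
qed

lemma rbl_quotient_universal:
  "\<exists>!h. h \<in> operated_hom ring_of_type_algebra (rbl_quotient lam) B
     \<and> h \<in> extensional (carrier (rbl_quotient lam)) \<and> (\<forall>x. h (rbl_class lam (bletter x)) = f x)"
proof -
  \<comment> \<open>Evaluation of a chosen representative; \<open>keval_Id_rbl\<close> makes the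
    choice irrelevant, and \<open>restrict\<close> supplies extensionality.\<close>
  define h where "h = restrict (\<lambda>C. keval B f (SOME g. g \<in> C)) (carrier (rbl_quotient lam))"
  note Q = quotient_simps[OF kideal_Id_rbl, of lam, folded rbl_quotient_def]
  have h: "h (kcoset (Id_rbl lam) g) = keval B f g" for g
  proof -
    have "(SOME h. h \<in> kcoset (Id_rbl lam) g) \<in> kcoset (Id_rbl lam) g"
      by (rule someI) (rule kcoset_self[OF kideal_Id_rbl])
    then show ?thesis
      by (simp add: h_def Q keval_Id_rbl mem_kcoset[OF kideal_Id_rbl])
  qed
  have h_hom: "h \<in> operated_hom ring_of_type_algebra (rbl_quotient lam) B"
    by (auto simp: operated_hom_def Q h keval_closed keval_linear keval_kmul keval_kbracket)
  have unique: "h' = h" if h': "h' \<in> operated_hom ring_of_type_algebra (rbl_quotient lam) B"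
    "h' \<in> extensional (carrier (rbl_quotient lam))" "\<forall>x. h' (rbl_class lam (bletter x)) = f x" for h'
  proof (rule extensionalityI[OF h'(2)])
    have hom: "h' (kcoset (Id_rbl lam) (g + g')) = h' (kcoset (Id_rbl lam) g) \<oplus>\<^bsub>B\<^esub> h' (kcoset (Id_rbl lam) g')"
      "h' (kcoset (Id_rbl lam) (kscale c g)) = c \<odot>\<^bsub>B\<^esub> h' (kcoset (Id_rbl lam) g)"
      "h' (kcoset (Id_rbl lam) (kmul g g')) = h' (kcoset (Id_rbl lam) g) \<otimes>\<^bsub>B\<^esub> h' (kcoset (Id_rbl lam) g')"
      "h' (kcoset (Id_rbl lam) (kbracket g)) = oper B (h' (kcoset (Id_rbl lam) g))"
      "h' (kcoset (Id_rbl lam) g) \<in> carrier B" for c g g'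
      using h'(1) by (auto simp: operated_hom_def Q)
    have letter: "h' (kcoset (Id_rbl lam) (kmono (bletter x))) = f x" for x
      using h'(3) by (simp add: rbl_class_def)
    have word: "h' (kcoset (Id_rbl lam) (kmono w)) = word_eval B f w"
      and prime: "h' (kcoset (Id_rbl lam) (kmono (Sing p))) = prime_eval B f p"
      for w :: "'x bword" and p :: "'x bprime"
    proof (induction w and p)
      case (Conc p w)
      then show ?case using hom(3)[of "kmono (Sing p)" "kmono w"] by simp
    next
      case (Brk w)
      then show ?case using hom(4)[of "kmono w"] by simp
    qed (simp_all add: letter)
    have "h' (kcoset (Id_rbl lam) g) = keval B f g" for g
    proof (induction g rule: kmono_keys_induct)
      case zero
      \<comment> \<open>Scaling by 0 shows that \<open>h'\<close> maps the zero coset to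
        zero.\<close>
      show ?case using hom(2)[of 0 0] hom(5)[of 0] by (simp add: zero_smult keval_zero)
    qed (simp_all add: word hom keval_kmono keval_linear)
    then show "h' C = h C" if "C \<in> carrier (rbl_quotient lam)" for C
      using that h by (auto simp: Q)
  qed (simp add: h_def)
  show ?thesis
  proof (rule ex1I[of _ h])
    show "h \<in> operated_hom ring_of_type_algebra (rbl_quotient lam) B
        \<and> h \<in> extensional (carrier (rbl_quotient lam)) \<and> (\<forall>x. h (rbl_class lam (bletter x)) = f x)"
      using h_hom by (simp add: rbl_class_def h keval_kmono) (simp add: h_def)
  qed (use unique in blast)
qed

end

theorem free_rbl_quotient:
  fixes lam :: "'k::comm_ring_1"
  shows "free_nonunitary_rota_baxter_algebra TYPE('b) ring_of_type_algebra lam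
    (rbl_quotient lam :: ('k, ('x bword \<Rightarrow>\<^sub>0 'k) set) operated_algebra) (\<lambda>x. rbl_class lam (bletter x))"
  unfolding free_nonunitary_rota_baxter_algebra_def
proof (intro conjI allI impI)
  show "nonunitary_rota_baxter_algebra ring_of_type_algebra (rbl_quotient lam :: ('k, ('x bword \<Rightarrow>\<^sub>0 'k) set) operated_algebra) lam"
    unfolding rbl_quotient_def by (rule rota_baxter_quotient[OF kideal_Id_rbl S_rbl_subset_Id_rbl])
  show "range (\<lambda>x. rbl_class lam (bletter x)) \<subseteq> carrier (rbl_quotient lam)"
    by (auto simp: rbl_quotient_def carrier_quotient[OF kideal_Id_rbl] rbl_class_def)
next
  fix B :: "('k, 'b) operated_algebra" and f :: "'x \<Rightarrow> 'b"
  assume "nonunitary_rota_baxter_algebra ring_of_type_algebra B lam \<and> range f \<subseteq> carrier B"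
  then show "\<exists>!h. h \<in> operated_hom ring_of_type_algebra (rbl_quotient lam) B
      \<and> h \<in> extensional (carrier (rbl_quotient lam)) \<and> (\<forall>x. h (rbl_class lam (bletter x)) = f x)"
    by (intro rbl_quotient_universal) simp_all
qed

text \<open>Spanning: \<open>f\<close> is congruent to N f, which has irreducible support.
  Independence: a vanishing combination of irreducible words lies in the ideal, so N sends it to
  zero, yet N fixes it.\<close>

theorem basis_rbl_quotient:
  fixes lam :: "'k::comm_ring_1"
  shows "basis_family ring_of_type_algebra
    (rbl_quotient lam :: ('k, ('x bword \<Rightarrow>\<^sub>0 'k) set) operated_algebra) Irr_rbl (rbl_class lam)"
proof -
  let ?Q = "rbl_quotient lam :: ('k, ('x bword \<Rightarrow>\<^sub>0 'k) set) operated_algebra"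
  let ?I = "Id_rbl lam :: ('x bword \<Rightarrow>\<^sub>0 'k) set"
  note Q = quotient_simps[OF kideal_Id_rbl, of lam, folded rbl_quotient_def]
  interpret Q: nonunitary_rota_baxter_algebra ring_of_type_algebra ?Q lam
    unfolding rbl_quotient_def by (rule rota_baxter_quotient[OF kideal_Id_rbl S_rbl_subset_Id_rbl])
  have finsum: "(\<Oplus>\<^bsub>?Q\<^esub>w\<in>F. c w \<odot>\<^bsub>?Q\<^esub> rbl_class lam w) = kcoset ?I (\<Sum>w\<in>F. kscale (c w) (kmono w))"
    if "finite F" for F :: "'x bword set" and c
    using that
  proof (induction F rule: finite_induct)
    case (insert w F)
    then show ?case
      by (subst Q.finsum_insert) (auto simp: Q rbl_class_def)
  qed (simp add: Q)
  have span: "\<exists>F c. finite F \<and> F \<subseteq> Irr_rbl \<and> c \<in> F \<rightarrow> carrier ring_of_type_algebra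
      \<and> m = (\<Oplus>\<^bsub>?Q\<^esub>w\<in>F. c w \<odot>\<^bsub>?Q\<^esub> rbl_class lam w)" if "m \<in> carrier ?Q" for m
  proof -
    obtain f where m: "m = kcoset ?I f" using \<open>m \<in> carrier ?Q\<close> by (auto simp: Q)
    let ?n = "knormal lam f"
    have "f - ?n \<in> ?I"
      using kidealD(7)[OF kideal_Id_rbl knormal_cong[OF kideal_Id_rbl S_rbl_subset_Id_rbl]] by fastforce
    then have "m = kcoset ?I ?n"
      unfolding m by (rule kcoset_eqI[OF kideal_Id_rbl])
    also have "\<dots> = (\<Oplus>\<^bsub>?Q\<^esub>w\<in>Poly_Mapping.keys ?n. Poly_Mapping.lookup ?n w \<odot>\<^bsub>?Q\<^esub> rbl_class lam w)"
      using finsum[of "Poly_Mapping.keys ?n" "Poly_Mapping.lookup ?n"] kmono_expansion[of ?n] by simp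
    finally show ?thesis
      using irreducible_knormal[of lam f] by (intro exI[of _ "Poly_Mapping.keys ?n"] exI[of _ "Poly_Mapping.lookup ?n"])
        (auto simp: Irr_rbl_eq)
  qed
  have indep: "\<forall>w\<in>F. c w = 0" if F: "finite F" "F \<subseteq> Irr_rbl"
    and zero: "(\<Oplus>\<^bsub>?Q\<^esub>w\<in>F. c w \<odot>\<^bsub>?Q\<^esub> rbl_class lam w) = \<zero>\<^bsub>?Q\<^esub>" for F c
  proof -
    let ?f = "\<Sum>w\<in>F. kscale (c w) (kmono w)"
    have lookup: "Poly_Mapping.lookup ?f v = (if v \<in> F then c v else 0)" for v
      using F(1) by (simp add: lookup_sum lookup_kmono if_distrib cong: if_cong)
    have "?f \<in> ?I"
      using zero kcoset_eq_iff[OF kideal_Id_rbl, of lam ?f 0] by (simp add: finsum[OF F(1)] Q)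
    then have "knormal lam ?f = 0"
      by (simp add: knormal_eq_zero_iff)
    moreover have "Poly_Mapping.keys ?f \<subseteq> Collect irreducible_word"
      using F(2) by (auto simp: in_keys_iff lookup Irr_rbl_eq split: if_splits)
    ultimately have "?f = 0"
      using knormal_irreducible by metis
    then show ?thesis
      using lookup by (metis lookup_zero)
  qed
  show ?thesis
    unfolding basis_family_def using span indep by (auto simp: Q rbl_class_def)
qed

theorem theorem4p2:
  fixes lam :: "'k::{comm_ring_1, ring_char_0}"
  shows "groebner_shirshov_basis pl_le (S_rbl lam :: ('x::wellorder bword \<Rightarrow>\<^sub>0 'k) set)
    \<and> free_nonunitary_rota_baxter_algebra TYPE('b) ring_of_type_algebra lam
         (rbl_quotient lam :: ('k, ('x bword \<Rightarrow>\<^sub>0 'k) set) operated_algebra)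
         (\<lambda>x. rbl_class lam (bletter x))
    \<and> basis_family ring_of_type_algebra
         (rbl_quotient lam :: ('k, ('x bword \<Rightarrow>\<^sub>0 'k) set) operated_algebra)
         Irr_rbl (rbl_class lam)"
  using groebner_shirshov_S_rbl free_rbl_quotient basis_rbl_quotient by blast

end
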